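(* Let $k\ge3$ and $m\ge1$. Then: (a) $\mathsf D(k,m)$ is a polytopal complex, and $\mathsf D_+(k,m)$ and $\mathsf D_+^t(k,m)$ are simplicial complexes. Moreover, $\mathsf D(k,m)$ arises as a linear section of $\mathsf D_+(k,m)$ and of $\mathsf D_+^t(k,m)$. (b) $\mathsf T(k,m)$ is the simplicial complex induced on the set of transversal $(m-2)$-dimensional faces of $\mathsf D_+(k,m)$. (c) The flip graph $D(k,m)$ is the $1$-skeleton of $\mathsf D(k,m)$.
   Context: Let $N=m(k-2)+2$ and consider a convex $N$-gon. $\delta(k,m)$ is the set of $k$-allowable diagonals: those that can appear in a dissection of the $N$-gon (by non-crossing diagonals) into $m$ convex $k$-gons. $I(k,m)$ is the graph on vertex set $\delta(k,m)$ in which two distinct diagonals are joined by an edge if their relative interiors do not intersect. $\mathsf T(k,m)$ is the simplicial complex on $\delta(k,m)$ whose simplices are the sets of pairwise non-crossing diagonals. The flip graph $D(k,m)$ has as vertices the dissections of the $N$-gon into $m$ convex $k$-gons (equivalently, the sets of $m-1$ pairwise non-crossing $k$-allowable diagonals), two being adjacent if they differ in the placement of exactly one diagonal. For a graph $H$ with $V(H)=[h]$ and $g\ge 0$: $\mathrm{Hom}(K_g,H)$ is the polytopal complex of all cells $\times_{i\in[g]}\sigma_i$ with $\emptyset\ne\sigma_i\subset V(H)$ such that for $i\ne j$ every $(u,v)\in\sigma_i\times\sigma_j$ is an edge of $H$. $\mathrm{Hom}_+(K_g,H)$ is the simplicial complex of all simplices $\star_{i\in[g]}\sigma_i$, $\sigma_i\subset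 V(H)$ possibly empty, with the same condition for all $i\ne j$ with $\sigma_i,\sigma_j$ both nonempty. A simplex $\star_i\sigma_i$ (and its projection) is transversal if all $\sigma_i$ are nonempty; $\mathrm{Hom}_+^t(K_g,H)$ is the subcomplex of $\mathrm{Hom}_+(K_g,H)$ consisting of all faces of transversal simplices. Subsets of $V(H)$ are identified with faces of $\Delta_{V(H)}=\mathrm{conv}\{e_1,\dots,e_h\}\subset\mathbb R^h$. Realize $\star_i\sigma_i$ as $\mathrm{conv}\bigcup_i\mu_i(\sigma_i)\times e_i\subset\mathbb R^{gh}\times\mathbb R^g$ and $\times_i\sigma_i$ as $\frac1g(\mu_1(\sigma_1)\times\dots\times\mu_g(\sigma_g))\times\frac{\mathbf 1}{g}$, where $\mu_i:\mathbb R^h\to(\mathbb R^h)^g$ is the $i$-th block inclusion and $\frac{\mathbf 1}{g}=(\frac1g,\dots,\frac1g)$. Let $\pi_\Box(x_1,\dots,x_g,y)=(x_1+\dots+x_g,y)\in\mathbb R^h\times\mathbb R^g$, let $\pi_\Delta:\mathbb R^h\times\mathbb R^g\to\mathbb R^h$ be the projection to the first factor, and $\pi=\pi_\Delta\pi_\Box$. Applying $\pi$ to a complex means taking the family of images of its cells, so $\pi(\times_i\sigma_i)=\frac1g(\sigma_1+\dots+\sigma_g)$ and $\pi(\star_i\sigma_i)=\mathrm{conv}\bigcup_i\sigma_i$. Set $$\mathsf D(k,m)=\pi\mathrm{Hom}(K_{m-1},I(k,m)),\quad \mathsf D_+(k,m)=\pi\mathrm{Hom}_+(K_{m-1},I(k,m)),\quad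 \mathsf D_+^t(k,m)=\pi\mathrm{Hom}_+^t(K_{m-1},I(k,m)).$$ "Linear section" is meant in the sense of the polyhedral Cayley trick: with $g=m-1$, $H=I(k,m)$, the family $\mathsf D(k,m)\times\frac{\mathbf 1}{g}$ is obtained by intersecting the cells of $\pi_\Box\mathrm{Hom}_+(K_g,H)$ (respectively $\pi_\Box\mathrm{Hom}_+^t(K_g,H)$), the lifts to $\mathbb R^h\times\mathbb R^g$ of $\mathsf D_+(k,m)$ (respectively $\mathsf D_+^t(k,m)$), with the affine subspace $\mathbb R^h\times\frac{\mathbf 1}{g}$, discarding empty intersections. The $1$-skeleton in (c) is taken as an abstract graph, the vertex $\pi(\{d_1\}\times\dots\times\{d_{m-1}\})$ of $\mathsf D(k,m)$ corresponding to the dissection $\{d_1,\dots,d_{m-1}\}$.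
   Formalization: The linear-section claim in (a) is stated only for m ≥ 2; for m = 1 we have g = 0, the point (1/g,…,1/g) is undefined, and the only simplex of Hom_+ is empty while D(k,1) is a single point. *)

theory Defs
  imports "HOL-Analysis.Analysis" "HOL-Analysis.Finite_Function_Topology"
begin

section \<open>Graphs\<close>

text \<open>A simple graph is a pair of a vertex set and a set of two-element edges.\<close>

type_synonym 'a graph = "'a set \<times> 'a set set"

abbreviation verts :: "'a graph \<Rightarrow> 'a set" where "verts \<equiv> fst"
abbreviation edges :: "'a graph \<Rightarrow> 'a set set" where "edges \<equiv> snd"

definition graph_iso :: "('a \<Rightarrow> 'b) \<Rightarrow> 'a graph \<Rightarrow> 'b graph \<Rightarrow> bool" where
  "graph_iso f G H \<longleftrightarrow> bij_betw f (verts G) (verts H) \<and> edges H = (\<lambda>e. f ` e) ` edges G"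

section \<open>Dissections of a convex polygon\<close>

definition convex_gon :: "nat \<Rightarrow> (real^2) set \<Rightarrow> bool" where
  "convex_gon n Q \<longleftrightarrow> polytope Q \<and> aff_dim Q = 2 \<and> card {v. v extreme_point_of Q} = n"

text \<open>Diagonals are the actual segments, not pairs of vertices: two vertices span a diagonal
  iff the segment between them is not a side, that is, not a face of the polygon.\<close>

definition diagonals :: "(real^2) set \<Rightarrow> (real^2) set set" where
  "diagonals Q = {closed_segment u v | u v.
     u extreme_point_of Q \<and> v extreme_point_of Q \<and> u \<noteq> v \<and> \<not> closed_segment u v face_of Q}"

definition noncrossing :: "(real^2) set \<Rightarrow> (real^2) set \<Rightarrow> bool" where
  "noncrossing d d' \<longleftrightarrow> rel_interior d \<inter> rel_interior d' = {}"

text \<open>A dissection is given by the set \<open>X\<close> of its diagonals. Its pieces are the closures of the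
  connected components of what is left of the interior of the polygon.\<close>

definition dissections :: "nat \<Rightarrow> nat \<Rightarrow> (real^2) set \<Rightarrow> (real^2) set set set" where
  "dissections k m Q = {X. X \<subseteq> diagonals Q \<and> pairwise noncrossing X \<and>
     card (components (interior Q - \<Union>X)) = m \<and>
     (\<forall>R \<in> components (interior Q - \<Union>X). convex_gon k (closure R))}"

definition allowable :: "nat \<Rightarrow> nat \<Rightarrow> (real^2) set \<Rightarrow> (real^2) set set" where
  "allowable k m Q = \<Union> (dissections k m Q)"

definition I_graph :: "nat \<Rightarrow> nat \<Rightarrow> (real^2) set \<Rightarrow> (real^2) set graph" where
  "I_graph k m Q = (allowable k m Q,
     {{d, d'} | d d'. d \<in> allowable k m Q \<and> d' \<in> allowable k m Q \<and> d \<noteq> d' \<and> noncrossing d d'})"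

definition T_complex :: "nat \<Rightarrow> nat \<Rightarrow> (real^2) set \<Rightarrow> (real^2) set set set" where
  "T_complex k m Q = {S. S \<subseteq> allowable k m Q \<and> pairwise noncrossing S}"

definition flip_graph :: "nat \<Rightarrow> nat \<Rightarrow> (real^2) set \<Rightarrow> (real^2) set set graph" where
  "flip_graph k m Q = (dissections k m Q,
     {{X, Y} | X Y. X \<in> dissections k m Q \<and> Y \<in> dissections k m Q \<and>
        card (X - Y) = 1 \<and> card (Y - X) = 1})"

section \<open>Polytopal and simplicial complexes\<close>

text \<open>The complexes below live in spaces whose dimension depends on \<open>k\<close> and \<open>m\<close>, which are
  realized inside types of finitely supported functions. The library notions \<^const>\<open>simplex\<close> and
  \<^const>\<open>simplicial_complex\<close> require a Euclidean space, so they are restated for real vector spaces;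
  there, finiteness of the vertex set no longer follows from affine independence.\<close>

definition is_simplex :: "int \<Rightarrow> 'a::real_vector set \<Rightarrow> bool" where
  "is_simplex n S \<longleftrightarrow>
     (\<exists>C. finite C \<and> \<not> affine_dependent C \<and> int (card C) = n + 1 \<and> S = convex hull C)"

definition is_simplicial_complex :: "'a::real_vector set set \<Rightarrow> bool" where
  "is_simplicial_complex K \<longleftrightarrow> finite K \<and>
     (\<forall>S \<in> K. \<exists>n. is_simplex n S) \<and>
     (\<forall>F S. S \<in> K \<and> F face_of S \<longrightarrow> F \<in> K) \<and>
     (\<forall>S S'. S \<in> K \<and> S' \<in> K \<longrightarrow> (S \<inter> S') face_of S)"

text \<open>Simplicial complexes contain the empty simplex. The cells of a polytopal complex are
  nonempty by convention, since those of \<open>Hom (K_g, H)\<close> are; note that \<^term>\<open>{} face_of S\<close> holds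
  for every \<open>S\<close>.\<close>

definition is_polytopal_complex :: "'a::real_vector set set \<Rightarrow> bool" where
  "is_polytopal_complex K \<longleftrightarrow> finite K \<and>
     (\<forall>P \<in> K. polytope P \<and> P \<noteq> {}) \<and>
     (\<forall>F P. P \<in> K \<and> F face_of P \<and> F \<noteq> {} \<longrightarrow> F \<in> K) \<and>
     (\<forall>P P'. P \<in> K \<and> P' \<in> K \<longrightarrow> (P \<inter> P') face_of P)"

definition one_skeleton :: "'a::real_vector set set \<Rightarrow> 'a graph" where
  "one_skeleton K = ({x. {x} \<in> K}, {{x, y} | x y. x \<noteq> y \<and> closed_segment x y \<in> K})"

section \<open>Hom complexes and their realizations\<close>

text \<open>Cells are tuples of vertex sets indexed by \<open>{..<g}\<close>.\<close>

definition joined :: "nat \<Rightarrow> 'a graph \<Rightarrow> (nat \<Rightarrow> 'a set) \<Rightarrow> bool" where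
  "joined g H \<sigma> \<longleftrightarrow> (\<forall>i<g. \<forall>j<g. i \<noteq> j \<longrightarrow> (\<forall>u \<in> \<sigma> i. \<forall>v \<in> \<sigma> j. {u, v} \<in> edges H))"

definition transversal :: "nat \<Rightarrow> (nat \<Rightarrow> 'a set) \<Rightarrow> bool" where
  "transversal g \<sigma> \<longleftrightarrow> (\<forall>i<g. \<sigma> i \<noteq> {})"

definition hom :: "nat \<Rightarrow> 'a graph \<Rightarrow> (nat \<Rightarrow> 'a set) set" where
  "hom g H = {\<sigma> \<in> {..<g} \<rightarrow>\<^sub>E (Pow (verts H) - {{}}). joined g H \<sigma>}"

definition hom_plus :: "nat \<Rightarrow> 'a graph \<Rightarrow> (nat \<Rightarrow> 'a set) set" where
  "hom_plus g H = {\<sigma> \<in> {..<g} \<rightarrow>\<^sub>E Pow (verts H). joined g H \<sigma>}"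

definition hom_plus_t :: "nat \<Rightarrow> 'a graph \<Rightarrow> (nat \<Rightarrow> 'a set) set" where
  "hom_plus_t g H = {\<tau> \<in> hom_plus g H. \<exists>\<sigma> \<in> hom_plus g H. transversal g \<sigma> \<and> (\<forall>i<g. \<tau> i \<subseteq> \<sigma> i)}"

text \<open>\<open>\<real>\<^sup>h\<close> with coordinates indexed by a vertex set \<open>V\<close> is the subspace of \<^typ>\<open>'a \<Rightarrow>\<^sub>0 real\<close> of
  functions supported in \<open>V\<close>, and \<open>(\<real>\<^sup>h)\<^sup>g\<close> and \<open>\<real>\<^sup>g\<close> are treated likewise. The block inclusion
  \<open>\<mu>_i\<close> is then \<^term>\<open>Poly_Mapping.single i\<close>.\<close>

definition coord_space :: "'a set \<Rightarrow> ('a \<Rightarrow>\<^sub>0 real) set" where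
  "coord_space V = {x. Poly_Mapping.keys x \<subseteq> V}"

definition unit_vec :: "'a \<Rightarrow> ('a \<Rightarrow>\<^sub>0 real)" where
  "unit_vec d = Poly_Mapping.single d 1"

definition face :: "'a set \<Rightarrow> ('a \<Rightarrow>\<^sub>0 real) set" where
  "face S = convex hull (unit_vec ` S)"

definition barycenter :: "nat \<Rightarrow> (nat \<Rightarrow>\<^sub>0 real)" where
  "barycenter g = (1 / real g) *\<^sub>R (\<Sum>i<g. unit_vec i)"

type_synonym 'a cayley = "(nat \<Rightarrow>\<^sub>0 ('a \<Rightarrow>\<^sub>0 real)) \<times> (nat \<Rightarrow>\<^sub>0 real)"

definition real_join :: "nat \<Rightarrow> (nat \<Rightarrow> 'a set) \<Rightarrow> 'a cayley set" where
  "real_join g \<sigma> = convex hull (\<Union>i<g. Poly_Mapping.single i ` face (\<sigma> i) \<times> {unit_vec i})"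

definition real_prod :: "nat \<Rightarrow> (nat \<Rightarrow> 'a set) \<Rightarrow> 'a cayley set" where
  "real_prod g \<sigma> =
     {(1 / real g) *\<^sub>R (\<Sum>i<g. Poly_Mapping.single i (x i)) | x. \<forall>i<g. x i \<in> face (\<sigma> i)} \<times> {barycenter g}"

definition proj_box :: "nat \<Rightarrow> 'a cayley \<Rightarrow> ('a \<Rightarrow>\<^sub>0 real) \<times> (nat \<Rightarrow>\<^sub>0 real)" where
  "proj_box g = (\<lambda>(x, y). (\<Sum>i<g. Poly_Mapping.lookup x i, y))"

definition proj :: "nat \<Rightarrow> 'a cayley \<Rightarrow> ('a \<Rightarrow>\<^sub>0 real)" where
  "proj g = fst \<circ> proj_box g"

definition D_complex :: "nat \<Rightarrow> nat \<Rightarrow> (real^2) set \<Rightarrow> ((real^2) set \<Rightarrow>\<^sub>0 real) set set" where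
  "D_complex k m Q = (\<lambda>\<sigma>. proj (m - 1) ` real_prod (m - 1) \<sigma>) ` hom (m - 1) (I_graph k m Q)"

definition D_plus :: "nat \<Rightarrow> nat \<Rightarrow> (real^2) set \<Rightarrow> ((real^2) set \<Rightarrow>\<^sub>0 real) set set" where
  "D_plus k m Q = (\<lambda>\<sigma>. proj (m - 1) ` real_join (m - 1) \<sigma>) ` hom_plus (m - 1) (I_graph k m Q)"

definition D_plus_t :: "nat \<Rightarrow> nat \<Rightarrow> (real^2) set \<Rightarrow> ((real^2) set \<Rightarrow>\<^sub>0 real) set set" where
  "D_plus_t k m Q = (\<lambda>\<sigma>. proj (m - 1) ` real_join (m - 1) \<sigma>) ` hom_plus_t (m - 1) (I_graph k m Q)"

definition transversal_faces :: "nat \<Rightarrow> nat \<Rightarrow> (real^2) set \<Rightarrow> ((real^2) set \<Rightarrow>\<^sub>0 real) set set" where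
  "transversal_faces k m Q = (\<lambda>\<sigma>. proj (m - 1) ` real_join (m - 1) \<sigma>) `
     {\<sigma> \<in> hom_plus (m - 1) (I_graph k m Q). transversal (m - 1) \<sigma>}"

definition induced_complex :: "'a::real_vector set set \<Rightarrow> 'a set set" where
  "induced_complex \<F> = {F. \<exists>P \<in> \<F>. F face_of P}"

text \<open>The Cayley section: intersect all cells with \<open>\<real>\<^sup>h \<times> {barycenter g}\<close> and drop the empty
  intersections. This is meaningful only for \<open>g \<ge> 1\<close>: there is no point \<open>(1/g, \<dots>, 1/g)\<close> for
  \<open>g = 0\<close>, where moreover the only join is the empty simplex while the empty product is a point.\<close>

definition cayley_section ::
    "nat \<Rightarrow> 'a set \<Rightarrow> (('a \<Rightarrow>\<^sub>0 real) \<times> (nat \<Rightarrow>\<^sub>0 real)) set set \<Rightarrow> (('a \<Rightarrow>\<^sub>0 real) \<times> (nat \<Rightarrow>\<^sub>0 real)) set set" where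
  "cayley_section g V K = (\<lambda>S. S \<inter> (coord_space V \<times> {barycenter g})) ` K - {{}}"

definition lifted :: "nat \<Rightarrow> (nat \<Rightarrow> 'a set) set \<Rightarrow> (('a \<Rightarrow>\<^sub>0 real) \<times> (nat \<Rightarrow>\<^sub>0 real)) set set" where
  "lifted g C = (\<lambda>\<sigma>. proj_box g ` real_join g \<sigma>) ` C"

end

theory Submission
  imports Defs
begin

text \<open>Cutting a convex polygon along a diagonal yields two convex polygons, so by induction a set of
  \<open>n\<close> noncrossing diagonals leaves \<open>n + 1\<close> convex pieces, and an allowable diagonal has a multiple of
  \<open>k - 2\<close> vertices on each side. Conversely, cutting along a set of noncrossing allowable diagonals
  produces polygons with \<open>2\<close> modulo \<open>k - 2\<close> vertices, which can be cut up further into \<open>k\<close>-gons.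
  Hence the cliques of \<open>I(k,m)\<close> are the subsets of dissections and have at most \<open>m - 1\<close> elements.
  This is all that is needed to know about \<open>I(k,m)\<close>: in a graph without cliques of more than \<open>g\<close>
  vertices, the blocks of a cell of \<open>Hom (K_g, H)\<close> are independent sets, hence they are determined by
  the support of any point of the projected cell, and projected cells meet in common faces.\<close>

section \<open>Convex polygons and their dissections\<close>

text \<open>The modulus \<open>k - 2\<close> comes from an additive quantity: a cut along a diagonal
  keeps both ends as vertices of either side, so the number of vertices minus two is additive over
  the pieces, and a \<open>k\<close>-gon contributes \<open>k - 2\<close>. The obstacle in the
  second half is that \<open>proj\<close> adds up the blocks of a cell and forgets which block a
  coordinate came from, so projected cells might overlap in sets that are not faces. For joins this
  is harmless: their images are faces of one standard simplex. For products, a graph without loops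
  makes the blocks of a cell disjoint, and a projected cell is then the part of a coordinate orthant
  on which each block has coordinate sum \<open>1 / real g\<close>. In this form a face is obtained
  by deleting coordinates. Comparing two cells thus means comparing two systems of block equations
  on the common support; the clique bound forces these systems to agree there.\<close>

lemma collinear_hyperplane_plane:
  fixes a :: "real^2"
  assumes "a \<noteq> 0" "a \<bullet> x = b" "a \<bullet> y = b" "a \<bullet> z = b"
  shows "collinear {x, y, z}"
proof -
  have "collinear {x. a \<bullet> x = b}"
    using assms(1) by (simp add: collinear_aff_dim)
  then show ?thesis
    by (rule collinear_subset) (use assms in auto)
qed

text \<open>A further point of \<open>Q\<close> on the line would be collinear with \<open>u\<close>
  and \<open>v\<close> but outside their segment, which puts one of these two vertices strictly
  between two points of \<open>Q\<close>.\<close>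

lemma Int_line_eq_segment:
  fixes a :: "real^2"
  assumes "convex Q" "a \<noteq> 0" and u: "u extreme_point_of Q" "a \<bullet> u = b"
    and v: "v extreme_point_of Q" "a \<bullet> v = b" and "u \<noteq> v"
  shows "Q \<inter> {x. a \<bullet> x = b} = closed_segment u v"
proof
  have uv: "u \<in> Q" "v \<in> Q" using u v by (auto simp: extreme_point_of_def)
  show "closed_segment u v \<subseteq> Q \<inter> {x. a \<bullet> x = b}"
    by (rule closed_segment_subset) (use uv u v assms(1) in \<open>auto intro: convex_Int convex_hyperplane\<close>)
  show "Q \<inter> {x. a \<bullet> x = b} \<subseteq> closed_segment u v"
  proof
    fix w assume w: "w \<in> Q \<inter> {x. a \<bullet> x = b}"
    then have "collinear {w, u, v}"
      using collinear_hyperplane_plane[of a w b u v] assms by auto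
    then consider "w \<in> closed_segment u v" | "u \<in> closed_segment v w" | "v \<in> closed_segment w u"
      by (auto simp: collinear_between_cases between_mem_segment)
    then show "w \<in> closed_segment u v"
    proof cases
      case 2
      then have "u = w" using u w uv \<open>u \<noteq> v\<close>
        by (auto simp: extreme_point_of_def open_segment_def)
      then show ?thesis by simp
    next
      case 3
      then have "v = w" using v w uv \<open>u \<noteq> v\<close>
        by (auto simp: extreme_point_of_def open_segment_def)
      then show ?thesis by simp
    qed auto
  qed
qed

lemma interior_nonempty_if_aff_dim_2:
  fixes Q :: "(real^2) set"
  assumes "convex Q" "aff_dim Q = 2"
  shows "interior Q \<noteq> {}"
proof -
  have "rel_interior Q \<noteq> {}"
    using assms by (auto simp: rel_interior_eq_empty)
  moreover have "rel_interior Q = interior Q"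
    by (rule rel_interior_interior) (use assms aff_dim_eq_full[of Q] in auto)
  ultimately show ?thesis by simp
qed

text \<open>At a boundary point of \<open>Q\<close> there is a supporting line. If the point is
  inside the segment, the functional attains its minimum over \<open>Q\<close> there and is
  therefore constant on the segment; the line then cuts out exactly the segment, which would make it
  a face.\<close>

lemma open_segment_subset_interior:
  fixes Q :: "(real^2) set"
  assumes Q: "polytope Q" "aff_dim Q = 2" and u: "u extreme_point_of Q" and v: "v extreme_point_of Q"
    and "u \<noteq> v" "\<not> closed_segment u v face_of Q"
  shows "open_segment u v \<subseteq> interior Q"
proof (rule ccontr)
  have cQ: "convex Q" "closed Q"
    using Q by (auto simp: polytope_imp_convex polytope_imp_closed)
  have uv: "u \<in> Q" "v \<in> Q" using u v by (auto simp: extreme_point_of_def)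
  assume "\<not> ?thesis"
  then obtain p where p: "p \<in> open_segment u v" "p \<notin> interior Q" by blast
  have "p \<in> Q" using p(1) closed_segment_subset[OF uv cQ(1)] segment_open_subset_closed by blast
  have "rel_interior Q = interior Q"
    by (rule rel_interior_interior) (use assms aff_dim_eq_full[of Q] in auto)
  then obtain c where c: "c \<noteq> 0" "\<And>y. y \<in> Q \<Longrightarrow> c \<bullet> p \<le> c \<bullet> y"
    using supporting_hyperplane_relative_frontier[OF cQ(1), of p] \<open>p \<in> Q\<close> p(2)
    unfolding closure_closed[OF cQ(2)] by metis
  obtain t where t: "0 < t" "t < 1" "p = (1 - t) *\<^sub>R u + t *\<^sub>R v"
    using p(1) by (auto simp: in_segment)
  have cp: "c \<bullet> p = (1 - t) * (c \<bullet> u) + t * (c \<bullet> v)" by (simp add: t inner_simps)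
  have "c \<bullet> p \<le> c \<bullet> u" "c \<bullet> p \<le> c \<bullet> v" using c(2) uv by auto
  moreover have "(1 - t) * (c \<bullet> u - c \<bullet> p) + t * (c \<bullet> v - c \<bullet> p) = 0"
    unfolding left_diff_distrib right_diff_distrib using cp by (simp add: algebra_simps)
  moreover have "(1 - t) * (c \<bullet> u - c \<bullet> p) \<ge> 0" "t * (c \<bullet> v - c \<bullet> p) \<ge> 0"
    using c(2)[OF uv(1)] c(2)[OF uv(2)] t by simp_all
  ultimately have "(1 - t) * (c \<bullet> u - c \<bullet> p) = 0" "t * (c \<bullet> v - c \<bullet> p) = 0" by linarith+
  then have "c \<bullet> u = c \<bullet> p" "c \<bullet> v = c \<bullet> p" using t by auto
  then have "Q \<inter> {x. c \<bullet> x = c \<bullet> p} = closed_segment u v"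
    by (intro Int_line_eq_segment) (use c cQ u v \<open>u \<noteq> v\<close> in auto)
  moreover have "(Q \<inter> {x. c \<bullet> x = c \<bullet> p}) face_of Q"
    by (rule face_of_Int_supporting_hyperplane_ge) (use c cQ in auto)
  ultimately show False using assms by simp
qed

lemma diagonalsE:
  assumes "d \<in> diagonals Q"
  obtains u v where "d = closed_segment u v" "u extreme_point_of Q" "v extreme_point_of Q" "u \<noteq> v"
    "\<not> closed_segment u v face_of Q"
  using assms unfolding diagonals_def by blast

lemma diagonal_rel_interior_subset:
  assumes "polytope Q" "aff_dim Q = 2" "d \<in> diagonals Q"
  shows "rel_interior d \<subseteq> interior Q"
  using assms(3) by (elim diagonalsE) (simp add: open_segment_subset_interior assms rel_interior_closed_segment)

text \<open>Openness of both sets keeps a connected subset of the union inside one of them, so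
  maximality can be tested in one set at a time.\<close>

lemma components_Un_open:
  assumes "open A" "open B" "A \<inter> B = {}"
  shows "components (A \<union> B) = components A \<union> components B"
proof -
  have *: "C \<subseteq> A \<or> C \<subseteq> B" if "connected C" "C \<subseteq> A \<union> B" for C
    using that assms unfolding connected_def by blast
  show ?thesis
  proof (intro set_eqI iffI)
    fix C assume C: "C \<in> components (A \<union> B)"
    then have "C \<noteq> {}" "C \<subseteq> A \<union> B" "connected C"
        and m: "\<And>D. D \<noteq> {} \<Longrightarrow> C \<subseteq> D \<Longrightarrow> D \<subseteq> A \<union> B \<Longrightarrow> connected D \<Longrightarrow> D = C"
      by (auto simp: in_components_maximal)
    then show "C \<in> components A \<union> components B"
      using *[of C] m unfolding Un_iff in_components_maximal by (metis le_supI1 le_supI2)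
  next
    fix C assume C: "C \<in> components A \<union> components B"
    have C': "C \<noteq> {}" "C \<subseteq> A \<union> B" "connected C"
      using C by (auto simp: in_components_maximal)
    have "D = C" if "D \<noteq> {}" "C \<subseteq> D" "D \<subseteq> A \<union> B" "connected D" for D
      using *[OF that(4,3)]
    proof
      assume "D \<subseteq> A"
      moreover have "C \<noteq> {}" using C in_components_nonempty by blast
      ultimately have "\<not> C \<subseteq> B" using that assms(3) by blast
      then have "C \<in> components A" using C in_components_subset by blast
      then show ?thesis using that \<open>D \<subseteq> A\<close> by (auto simp: in_components_maximal)
    next
      assume "D \<subseteq> B"
      moreover have "C \<noteq> {}" using C in_components_nonempty by blast
      ultimately have "\<not> C \<subseteq> A" using that assms(3) by blast
      then have "C \<in> components B" using C in_components_subset by blast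
      then show ?thesis using that \<open>D \<subseteq> B\<close> by (auto simp: in_components_maximal)
    qed
    then show "C \<in> components (A \<union> B)"
      using C' by (simp add: in_components_maximal)
  qed
qed

section \<open>Vertices and diagonals of the two sides of a cut\<close>

text \<open>The side \<open>a \<bullet> x \<ge> b\<close> of the cut is the side \<open>\<le>\<close> of the cut \<open>(-a, -b)\<close>, so that every
  statement about one side applies to both.\<close>

locale diagonal_cut =
  fixes Q :: "(real^2) set" and a :: "real^2" and b :: real and u v :: "real^2"
  assumes polytope: "polytope Q" and aff_dim: "aff_dim Q = 2"
    and u: "u extreme_point_of Q" and v: "v extreme_point_of Q"
    and u_neq_v: "u \<noteq> v" and not_face: "\<not> closed_segment u v face_of Q"
    and a_nz: "a \<noteq> 0" and au: "a \<bullet> u = b" and av: "a \<bullet> v = b"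

lemma diagonal_cut_minus: "diagonal_cut Q a b u v \<Longrightarrow> diagonal_cut Q (-a) (-b) u v"
  by (auto simp: diagonal_cut_def)

context diagonal_cut
begin

abbreviation "d \<equiv> closed_segment u v"
abbreviation "lo \<equiv> Q \<inter> {x. a \<bullet> x \<le> b}"
abbreviation "hi \<equiv> Q \<inter> {x. (-a) \<bullet> x \<le> -b}"

lemma convex: "convex Q" and closed: "closed Q"
  using polytope by (auto simp: polytope_imp_convex polytope_imp_closed)

lemma diagonal: "d \<in> diagonals Q"
  using u v u_neq_v not_face by (auto simp: diagonals_def)

lemma Int_line: "Q \<inter> {x. a \<bullet> x = b} = d"
  by (rule Int_line_eq_segment) (use convex a_nz u v au av u_neq_v in auto)

lemma extreme_on_line: "w extreme_point_of Q \<Longrightarrow> a \<bullet> w = b \<Longrightarrow> w = u \<or> w = v"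
proof -
  assume w: "w extreme_point_of Q" "a \<bullet> w = b"
  then have "w \<in> d" using Int_line by (auto simp: extreme_point_of_def)
  then show ?thesis using w u v by (auto simp: extreme_point_of_def open_segment_def)
qed

lemma Q_hull: "Q = convex hull {w. w extreme_point_of Q}"
  by (rule Krein_Milman_Minkowski) (use polytope in \<open>auto simp: polytope_imp_convex polytope_imp_compact\<close>)

lemma finite_extreme: "finite {w. w extreme_point_of Q}"
  using polytope by (simp add: finite_polyhedron_extreme_points polytope_imp_polyhedron)

text \<open>Otherwise the line would support \<open>Q\<close>, and its intersection with
  \<open>Q\<close>, which is \<open>d\<close>, would be a face.\<close>

lemma ex_extreme_less: "\<exists>w. w extreme_point_of Q \<and> a \<bullet> w < b"
proof (rule ccontr)
  assume "\<not> ?thesis"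
  then have "{w. w extreme_point_of Q} \<subseteq> {x. a \<bullet> x \<ge> b}" by auto
  then have "Q \<subseteq> {x. a \<bullet> x \<ge> b}"
    by (subst Q_hull) (rule hull_minimal, auto simp: convex_halfspace_ge)
  then have "(Q \<inter> {x. a \<bullet> x = b}) face_of Q"
    by (intro face_of_Int_supporting_hyperplane_ge convex) auto
  then show False using Int_line not_face by simp
qed

lemma interior_lo: "interior lo = interior Q \<inter> {x. a \<bullet> x < b}"
  using a_nz by (simp add: interior_halfspace_le)

text \<open>The open half-plane contains a vertex of \<open>Q\<close>; as \<open>Q\<close> is the
  closure of its interior, it contains interior points as well.\<close>

lemma aff_dim_lo: "aff_dim lo = 2"
proof -
  obtain w where w: "w extreme_point_of Q" "a \<bullet> w < b" using ex_extreme_less by blast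
  have "closure (interior Q) = Q"
    using convex_closure_interior[OF convex interior_nonempty_if_aff_dim_2[OF convex aff_dim]] closed
    by simp
  then have "w \<in> closure (interior Q)" using w by (auto simp: extreme_point_of_def)
  moreover have "open {x. a \<bullet> x < b}" by (rule open_halfspace_lt)
  ultimately have "interior Q \<inter> {x. a \<bullet> x < b} \<noteq> {}"
    using w(2) open_Int_closure_eq_empty[of "{x. a \<bullet> x < b}" "interior Q"] by blast
  then show ?thesis using aff_dim_nonempty_interior[of lo] interior_lo by simp
qed

lemma polytope_lo: "polytope lo"
  by (intro polytope_Int_polyhedron polytope polyhedron_halfspace_le)

lemma d_subset_lo: "d \<subseteq> lo"
  using Int_line by auto

lemma d_face_lo: "d face_of lo"
proof -
  have "(lo \<inter> {x. a \<bullet> x = b}) face_of lo"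
    by (rule face_of_Int_supporting_hyperplane_le) (use convex in \<open>auto intro: convex_Int convex_halfspace_le\<close>)
  moreover have "lo \<inter> {x. a \<bullet> x = b} = d" using Int_line by auto
  ultimately show ?thesis by simp
qed

text \<open>The cut creates no new vertices because the line meets \<open>Q\<close> in a segment
  whose ends are vertices already. Away from the line, being extreme is a local property, so it is
  the same for \<open>lo\<close> and \<open>Q\<close>.\<close>

lemma extreme_lo_iff: "w extreme_point_of lo \<longleftrightarrow> w extreme_point_of Q \<and> a \<bullet> w \<le> b"
proof
  assume w: "w extreme_point_of lo"
  then have wQ: "w \<in> Q" "a \<bullet> w \<le> b" by (auto simp: extreme_point_of_def)
  show "w extreme_point_of Q \<and> a \<bullet> w \<le> b"
  proof (cases "a \<bullet> w = b")
    case True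
    then have "w \<in> d" using wQ Int_line by auto
    moreover have "u \<in> lo" "v \<in> lo" using d_subset_lo by auto
    ultimately have "w = u \<or> w = v" using w by (auto simp: extreme_point_of_def open_segment_def)
    then show ?thesis using u v au av by auto
  next
    case False
    with wQ have lt: "a \<bullet> w < b" by simp
    have "w \<notin> open_segment y z" if yz: "y \<in> Q" "z \<in> Q" for y z
    proof
      assume o: "w \<in> open_segment y z"
      \<comment> \<open>\<open>M\<close> bounds both \<open>a \<bullet> (y - w)\<close> and
        \<open>a \<bullet> (z - w)\<close>. Contracting the segment towards \<open>w\<close> by the
        factor \<open>e\<close> therefore keeps its ends in the closed half-plane.\<close>
      define M where "M = \<bar>a \<bullet> y\<bar> + \<bar>a \<bullet> z\<bar> + \<bar>a \<bullet> w\<bar> + 1"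
      define e where "e = min 1 ((b - a \<bullet> w) / M)"
      have "M > 0" by (simp add: M_def)
      then have e: "0 < e" "e \<le> 1" "e * M \<le> b - a \<bullet> w"
        using lt by (auto simp: e_def min_def field_simps)
      have in_lo: "w + e *\<^sub>R (x - w) \<in> lo" if x: "x = y \<or> x = z" for x
      proof -
        have "a \<bullet> (x - w) \<le> M" using x by (auto simp: M_def inner_simps)
        then have "e * (a \<bullet> (x - w)) \<le> e * M" using e by simp
        then have "a \<bullet> (w + e *\<^sub>R (x - w)) \<le> b"
          unfolding inner_add_right inner_scaleR_right using e(3) by linarith
        moreover have "(1 - e) *\<^sub>R w + e *\<^sub>R x \<in> Q"
          using convexD_alt[OF convex wQ(1), of x e] x yz e by auto
        moreover have "w + e *\<^sub>R (x - w) = (1 - e) *\<^sub>R w + e *\<^sub>R x" by (simp add: algebra_simps)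
        ultimately show ?thesis by simp
      qed
      obtain t where t: "0 < t" "t < 1" "w = (1 - t) *\<^sub>R y + t *\<^sub>R z" and "y \<noteq> z"
        using o by (auto simp: in_segment)
      have "(1 - t) *\<^sub>R (w + e *\<^sub>R (y - w)) + t *\<^sub>R (w + e *\<^sub>R (z - w))
          = w + e *\<^sub>R ((1 - t) *\<^sub>R y + t *\<^sub>R z - w)"
        by (simp add: algebra_simps)
      also have "\<dots> = w" using t(3) by simp
      finally have "w = (1 - t) *\<^sub>R (w + e *\<^sub>R (y - w)) + t *\<^sub>R (w + e *\<^sub>R (z - w))" by simp
      moreover have "w + e *\<^sub>R (y - w) \<noteq> w + e *\<^sub>R (z - w)" using e \<open>y \<noteq> z\<close> by simp
      ultimately have "w \<in> open_segment (w + e *\<^sub>R (y - w)) (w + e *\<^sub>R (z - w))"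
        using t by (auto simp: in_segment)
      then show False using w in_lo by (auto simp: extreme_point_of_def)
    qed
    then show ?thesis using wQ by (auto simp: extreme_point_of_def)
  qed
next
  assume "w extreme_point_of Q \<and> a \<bullet> w \<le> b"
  then show "w extreme_point_of lo" by (auto simp: extreme_point_of_def)
qed

lemma card_extreme_lo:
  "card {w. w extreme_point_of lo} = card {w. w extreme_point_of Q \<and> a \<bullet> w < b} + 2"
proof -
  have "{w. w extreme_point_of lo} = {w. w extreme_point_of Q \<and> a \<bullet> w < b} \<union> {u, v}"
    unfolding extreme_lo_iff using u v au av extreme_on_line by force
  moreover have "{w. w extreme_point_of Q \<and> a \<bullet> w < b} \<inter> {u, v} = {}" using au av by auto
  moreover have "finite {w. w extreme_point_of Q \<and> a \<bullet> w < b}"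
    using finite_extreme by (rule finite_subset[rotated]) auto
  ultimately show ?thesis using u_neq_v by (simp add: card_Un_disjoint)
qed

lemma card_extreme_less_pos: "card {w. w extreme_point_of Q \<and> a \<bullet> w < b} > 0"
proof -
  have "finite {w. w extreme_point_of Q \<and> a \<bullet> w < b}"
    using finite_extreme by (rule finite_subset[rotated]) auto
  then show ?thesis using ex_extreme_less by (auto simp: card_gt_0_iff)
qed

text \<open>A face of \<open>Q\<close> contained in \<open>lo\<close> is a face of
  \<open>lo\<close>, so no diagonal of \<open>lo\<close> is a side of \<open>Q\<close>. The cut
  itself is excluded because it has become a side of \<open>lo\<close>.\<close>

lemma diagonals_lo_subset: "diagonals lo \<subseteq> diagonals Q - {d}"
proof
  fix e assume "e \<in> diagonals lo"
  then obtain s t where e: "e = closed_segment s t" "s extreme_point_of lo" "t extreme_point_of lo"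
     "s \<noteq> t" "\<not> closed_segment s t face_of lo" by (rule diagonalsE)
  have "closed_segment s t \<subseteq> lo"
    by (rule closed_segment_subset) (use e convex in \<open>auto simp: extreme_point_of_def intro: convex_Int convex_halfspace_le\<close>)
  then have "\<not> closed_segment s t face_of Q"
    using e(5) face_of_subset[of "closed_segment s t" Q lo] by blast
  moreover have "e \<noteq> d" using e(1,5) d_face_lo by metis
  ultimately show "e \<in> diagonals Q - {d}"
    using e unfolding diagonals_def extreme_lo_iff by blast
qed

text \<open>The midpoint of a diagonal is interior to \<open>Q\<close>. Strictly below the line it
  is interior to \<open>lo\<close>, and a face containing it would be all of \<open>lo\<close>; on
  the line, both ends are on the line too, and the diagonal is \<open>d\<close>.\<close>

lemma diagonal_in_lo:
  assumes e: "e \<in> diagonals Q" "e \<noteq> d" "e \<subseteq> {x. a \<bullet> x \<le> b}"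
  shows "e \<in> diagonals lo"
proof -
  obtain s t where st: "e = closed_segment s t" "s extreme_point_of Q" "t extreme_point_of Q"
     "s \<noteq> t" "\<not> closed_segment s t face_of Q" using e(1) by (rule diagonalsE)
  have le: "a \<bullet> s \<le> b" "a \<bullet> t \<le> b" using st(1) e(3) by auto
  have "\<not> closed_segment s t face_of lo"
  proof
    assume f: "closed_segment s t face_of lo"
    define p where "p = midpoint s t"
    have p: "p \<in> open_segment s t" using st by (simp add: p_def)
    have pint: "p \<in> interior Q"
      using open_segment_subset_interior[OF polytope aff_dim st(2-5)] p by blast
    have ap: "2 * (a \<bullet> p) = a \<bullet> s + a \<bullet> t" by (simp add: p_def midpoint_def inner_simps)
    show False
    proof (cases "a \<bullet> p < b")
      case True
      then have "p \<in> interior lo" using pint interior_lo by auto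
      moreover have "p \<in> closed_segment s t" using p by (auto simp: open_segment_def)
      ultimately have "closed_segment s t = lo"
        using face_of_disjoint_interior[OF f] by blast
      moreover have "collinear (closed_segment s t)" by simp
      ultimately show False using aff_dim_lo by (simp add: collinear_aff_dim)
    next
      case False
      then have "a \<bullet> s = b" "a \<bullet> t = b" using le ap by linarith+
      then have "s = u \<and> t = v \<or> s = v \<and> t = u"
        using extreme_on_line[of s] extreme_on_line[of t] st by metis
      then show False using e(2) st(1) by (auto simp: closed_segment_commute)
    qed
  qed
  then show ?thesis using st le unfolding diagonals_def extreme_lo_iff by blast
qed

text \<open>The segment meets the line in a point of \<open>Q\<close>, hence of \<open>d\<close>.
  Lying strictly between two points of \<open>Q\<close>, it is neither \<open>u\<close> nor
  \<open>v\<close>, so it belongs to both relative interiors.\<close>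

lemma noncrossing_not_both_sides:
  assumes st: "s extreme_point_of Q" "t extreme_point_of Q"
    and nc: "noncrossing (closed_segment s t) d" and lt: "a \<bullet> s < b" "b < a \<bullet> t"
  shows False
proof -
  define l where "l = (b - a \<bullet> s) / (a \<bullet> t - a \<bullet> s)"
  define q where "q = (1 - l) *\<^sub>R s + l *\<^sub>R t"
  have l: "0 < l" "l < 1" using lt by (auto simp: l_def field_simps)
  have "s \<noteq> t" using lt by auto
  then have q: "q \<in> open_segment s t" using l by (auto simp: in_segment q_def)
  have "a \<bullet> q = a \<bullet> s + l * (a \<bullet> t - a \<bullet> s)" by (simp add: q_def inner_simps algebra_simps)
  also have "\<dots> = b" using lt by (simp add: l_def)
  finally have aq: "a \<bullet> q = b" .
  have "s \<in> Q" "t \<in> Q" using st by (auto simp: extreme_point_of_def)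
  then have "q \<in> Q" using q closed_segment_subset[OF _ _ convex, of s t] by (auto simp: open_segment_def)
  then have "q \<in> d" using aq Int_line by auto
  moreover have "q \<noteq> u" "q \<noteq> v"
    using u v q \<open>s \<in> Q\<close> \<open>t \<in> Q\<close> by (auto simp: extreme_point_of_def)
  ultimately have "q \<in> rel_interior d"
    using u_neq_v by (simp add: rel_interior_closed_segment open_segment_def)
  moreover have "q \<in> rel_interior (closed_segment s t)"
    using q \<open>s \<noteq> t\<close> by (simp add: rel_interior_closed_segment)
  ultimately show False using nc by (auto simp: noncrossing_def)
qed

lemma noncrossing_side:
  assumes e: "e \<in> diagonals Q" "noncrossing e d"
  shows "e \<subseteq> {x. a \<bullet> x \<le> b} \<or> e \<subseteq> {x. b \<le> a \<bullet> x}"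
proof -
  obtain s t where st: "e = closed_segment s t" "s extreme_point_of Q" "t extreme_point_of Q"
     "s \<noteq> t" "\<not> closed_segment s t face_of Q" using e(1) by (rule diagonalsE)
  have "\<not> (a \<bullet> s < b \<and> b < a \<bullet> t)" "\<not> (a \<bullet> t < b \<and> b < a \<bullet> s)"
    using noncrossing_not_both_sides[of s t] noncrossing_not_both_sides[of t s] st e(2)
    by (auto simp: closed_segment_commute)
  then have "(a \<bullet> s \<le> b \<and> a \<bullet> t \<le> b) \<or> (b \<le> a \<bullet> s \<and> b \<le> a \<bullet> t)" by linarith
  then show ?thesis
    unfolding st(1)
    using closed_segment_subset[of s "{x. a \<bullet> x \<le> b}" t] closed_segment_subset[of s "{x. b \<le> a \<bullet> x}" t]
    by (auto simp: convex_halfspace_le convex_halfspace_ge)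
qed

end

abbreviation num_vertices :: "(real^2) set \<Rightarrow> nat" where
  "num_vertices P \<equiv> card {v. v extreme_point_of P}"

text \<open>The quarter turn; \<open>rot (v - u)\<close> is a normal vector of the line through
  \<open>u\<close> and \<open>v\<close>.\<close>

definition rot :: "real^2 \<Rightarrow> real^2" where
  "rot w = vector [- (w $ 2), w $ 1]"

lemma rot_inner_self [simp]: "rot w \<bullet> w = 0"
  by (simp add: rot_def inner_vec_def sum_2)

lemma rot_eq_0_iff [simp]: "rot w = 0 \<longleftrightarrow> w = 0"
  by (auto simp: rot_def vec_eq_iff forall_2)

lemma exists_diagonal_cut:
  assumes "polytope Q" "aff_dim Q = 2" "d \<in> diagonals Q"
  obtains a b u v where "diagonal_cut Q a b u v" "d = closed_segment u v"
proof -
  obtain u v where d: "d = closed_segment u v" "u extreme_point_of Q" "v extreme_point_of Q" "u \<noteq> v"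
    "\<not> closed_segment u v face_of Q" using assms(3) by (rule diagonalsE)
  have "rot (v - u) \<bullet> v = rot (v - u) \<bullet> u"
    using rot_inner_self[of "v - u"] by (simp add: inner_diff_right)
  then have "diagonal_cut Q (rot (v - u)) (rot (v - u) \<bullet> u) u v"
    using assms d by (simp add: diagonal_cut_def)
  then show thesis using d(1) that by blast
qed

lemma finite_diagonals:
  assumes "polytope Q"
  shows "finite (diagonals Q)"
proof (rule finite_subset)
  let ?V = "{v. v extreme_point_of Q}"
  show "diagonals Q \<subseteq> (\<lambda>(u, v). closed_segment u v) ` (?V \<times> ?V)"
    unfolding diagonals_def by auto
  show "finite ((\<lambda>(u, v). closed_segment u v) ` (?V \<times> ?V))"
    using assms by (simp add: finite_polyhedron_extreme_points polytope_imp_polyhedron)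
qed

lemma diagonal_subset: "convex Q \<Longrightarrow> d \<in> diagonals Q \<Longrightarrow> d \<subseteq> Q"
  using closed_segment_subset by (elim diagonalsE) (auto simp: extreme_point_of_def)

lemma closed_diagonal: "d \<in> diagonals Q \<Longrightarrow> closed d"
  by (elim diagonalsE) simp

lemma noncrossing_sym: "noncrossing d e \<longleftrightarrow> noncrossing e d"
  by (auto simp: noncrossing_def)

section \<open>Splitting sets of noncrossing diagonals and their components\<close>

context diagonal_cut
begin

interpretation flip: diagonal_cut Q "-a" "-b" u v
  by (rule diagonal_cut_minus[OF diagonal_cut_axioms])

lemmas hi_facts =
  flip.polytope_lo flip.aff_dim_lo flip.card_extreme_lo flip.card_extreme_less_pos
  flip.diagonals_lo_subset flip.interior_lo

lemma num_vertices_eq: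
  "num_vertices Q = card {w. w extreme_point_of Q \<and> a \<bullet> w < b} +
     card {w. w extreme_point_of Q \<and> b < a \<bullet> w} + 2"
proof -
  let ?L = "{w. w extreme_point_of Q \<and> a \<bullet> w < b}" and ?H = "{w. w extreme_point_of Q \<and> b < a \<bullet> w}"
  have fin: "finite ?L" "finite ?H"
    using finite_extreme by (rule finite_subset[rotated], auto)+
  have "{w. w extreme_point_of Q} = (?L \<union> ?H) \<union> {u, v}"
  proof (intro set_eqI iffI)
    fix w assume "w \<in> {w. w extreme_point_of Q}"
    then show "w \<in> (?L \<union> ?H) \<union> {u, v}"
      using extreme_on_line[of w] by (cases "a \<bullet> w" b rule: linorder_cases) simp_all
  next
    fix w assume "w \<in> (?L \<union> ?H) \<union> {u, v}"
    then show "w \<in> {w. w extreme_point_of Q}" using u v by (elim UnE insertE) simp_all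
  qed
  then have "num_vertices Q = card ((?L \<union> ?H) \<union> {u, v})" by (rule arg_cong)
  also have "\<dots> = card (?L \<union> ?H) + card {u, v}"
    by (rule card_Un_disjoint) (use fin au av in auto)
  also have "card (?L \<union> ?H) = card ?L + card ?H"
    by (rule card_Un_disjoint) (use fin in auto)
  finally show ?thesis using u_neq_v by simp
qed

lemma noncrossing_d_lo:
  assumes "e \<in> diagonals lo"
  shows "noncrossing e d"
proof -
  have "rel_interior e \<subseteq> interior lo"
    by (rule diagonal_rel_interior_subset[OF polytope_lo aff_dim_lo assms])
  moreover have "rel_interior d \<subseteq> {x. a \<bullet> x = b}"
    using Int_line rel_interior_subset[of d] by blast
  ultimately show ?thesis using interior_lo by (auto simp: noncrossing_def)
qed

lemma noncrossing_lo_hi: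
  assumes "e \<in> diagonals lo" "f \<in> diagonals hi"
  shows "noncrossing e f"
proof -
  have "rel_interior e \<subseteq> interior lo" "rel_interior f \<subseteq> interior hi"
    using diagonal_rel_interior_subset assms polytope_lo aff_dim_lo flip.polytope_lo flip.aff_dim_lo
    by blast+
  then show ?thesis unfolding interior_lo flip.interior_lo noncrossing_def by force
qed

lemma diagonals_split:
  assumes X: "X \<subseteq> diagonals Q" "pairwise noncrossing X" "d \<in> X"
  shows "X = insert d (X \<inter> diagonals lo \<union> X \<inter> diagonals hi)"
proof -
  have "e \<in> diagonals lo \<or> e \<in> diagonals hi" if "e \<in> X" "e \<noteq> d" for e
  proof -
    have "noncrossing e d" using X that by (auto simp: pairwise_def)
    moreover have "e \<in> diagonals Q" using X(1) that by blast
    ultimately consider "e \<subseteq> {x. a \<bullet> x \<le> b}" | "e \<subseteq> {x. b \<le> a \<bullet> x}"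
      using noncrossing_side by blast
    then show ?thesis
    proof cases
      case 1
      then show ?thesis using diagonal_in_lo[of e] that X by blast
    next
      case 2
      then have "e \<subseteq> {x. (-a) \<bullet> x \<le> -b}" by (simp add: subset_iff)
      then show ?thesis using flip.diagonal_in_lo[of e] that X(1) by blast
    qed
  qed
  then show ?thesis using X(3) by auto
qed

text \<open>A common diagonal would be noncrossing with itself, which means that its relative
  interior is empty.\<close>

lemma diagonals_lo_hi_disjoint: "diagonals lo \<inter> diagonals hi = {}"
proof -
  have False if "e \<in> diagonals lo" "e \<in> diagonals hi" for e
  proof -
    have "noncrossing e e" using noncrossing_lo_hi that by blast
    then have "rel_interior e = {}" by (simp add: noncrossing_def)
    moreover have "convex e" "e \<noteq> {}" using that(1) by (auto elim!: diagonalsE)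
    ultimately show False by (simp add: rel_interior_eq_empty)
  qed
  then show ?thesis by blast
qed

text \<open>Diagonals of one side stay in its closed half-plane and miss the interior of the other
  side; removing \<open>d\<close> deletes exactly the part of the line inside the interior of
  \<open>Q\<close>.\<close>

lemma region_split:
  assumes "X \<subseteq> diagonals lo" "Y \<subseteq> diagonals hi"
  shows "interior Q - \<Union>(insert d (X \<union> Y)) = (interior lo - \<Union>X) \<union> (interior hi - \<Union>Y)"
proof -
  have "\<Union>X \<subseteq> lo" "\<Union>Y \<subseteq> hi"
    using assms diagonal_subset[OF polytope_imp_convex[OF polytope_lo]]
      diagonal_subset[OF polytope_imp_convex[OF flip.polytope_lo]] by blast+
  then have X: "\<Union>X \<inter> interior hi = {}" and Y: "\<Union>Y \<inter> interior lo = {}"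
    unfolding interior_lo flip.interior_lo by force+
  have "interior Q - d = interior lo \<union> interior hi"
  proof -
    have "interior Q \<inter> {x. a \<bullet> x = b} \<subseteq> d" using Int_line interior_subset by blast
    moreover have "d \<subseteq> {x. a \<bullet> x = b}" using Int_line by blast
    ultimately show ?thesis unfolding interior_lo flip.interior_lo by force
  qed
  then show ?thesis using X Y by auto
qed

lemma components_split:
  assumes "X \<subseteq> diagonals lo" "Y \<subseteq> diagonals hi"
  shows "components (interior Q - \<Union>(insert d (X \<union> Y))) =
     components (interior lo - \<Union>X) \<union> components (interior hi - \<Union>Y)"
    and "components (interior lo - \<Union>X) \<inter> components (interior hi - \<Union>Y) = {}"
proof -
  have "open (interior P - \<Union>Z)" if "polytope P" "Z \<subseteq> diagonals P" for P Z
    using that finite_subset[OF that(2) finite_diagonals] closed_diagonal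
    by (intro open_Diff open_interior closed_Union) auto
  then have o: "open (interior lo - \<Union>X)" "open (interior hi - \<Union>Y)"
    using assms polytope_lo flip.polytope_lo by blast+
  have dis: "(interior lo - \<Union>X) \<inter> (interior hi - \<Union>Y) = {}"
    unfolding interior_lo flip.interior_lo by auto
  show "components (interior Q - \<Union>(insert d (X \<union> Y))) =
     components (interior lo - \<Union>X) \<union> components (interior hi - \<Union>Y)"
    unfolding region_split[OF assms] by (rule components_Un_open[OF o dis])
  show "components (interior lo - \<Union>X) \<inter> components (interior hi - \<Union>Y) = {}"
  proof (rule ccontr)
    assume "\<not> ?thesis"
    then obtain C where "C \<in> components (interior lo - \<Union>X)" "C \<in> components (interior hi - \<Union>Y)"
      by blast
    then have "C \<subseteq> (interior lo - \<Union>X) \<inter> (interior hi - \<Union>Y)" "C \<noteq> {}"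
      using in_components_subset in_components_nonempty by (blast, blast)
    then show False using dis by blast
  qed
qed

text \<open>If \<open>w\<close> lay beyond the cut, the segment from \<open>w\<close> to the
  midpoint of the second diagonal would meet \<open>d\<close> in a point strictly on the side of
  \<open>w\<close>, contrary to the position of \<open>d\<close>. Consequently the number of
  vertices cut off by the second diagonal is the same in \<open>lo\<close> as in
  \<open>Q\<close>.\<close>

lemma extreme_less_subset_lo:
  assumes c: "diagonal_cut Q a' b' s t" and e: "closed_segment s t \<in> diagonals lo" and d: "d \<subseteq> {x. b' \<le> a' \<bullet> x}"
    and w: "w extreme_point_of Q" "a' \<bullet> w < b'"
  shows "a \<bullet> w \<le> b"
proof (rule ccontr)
  assume "\<not> a \<bullet> w \<le> b"
  then have aw: "a \<bullet> w > b" by simp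
  interpret c: diagonal_cut Q a' b' s t by (rule c)
  define p where "p = midpoint s t"
  have "p \<in> rel_interior (closed_segment s t)"
    using c.u_neq_v by (simp add: p_def rel_interior_closed_segment)
  then have p: "p \<in> interior lo"
    using diagonal_rel_interior_subset[OF polytope_lo aff_dim_lo e] by blast
  then have ap: "a \<bullet> p < b" and pQ: "p \<in> Q" using interior_lo interior_subset by auto
  have "2 * (a' \<bullet> p) = a' \<bullet> s + a' \<bullet> t" by (simp add: p_def midpoint_def inner_simps)
  then have a'p: "a' \<bullet> p = b'" using c.au c.av by simp
  define l where "l = (a \<bullet> w - b) / (a \<bullet> w - a \<bullet> p)"
  define q where "q = (1 - l) *\<^sub>R w + l *\<^sub>R p"
  have l: "0 < l" "l < 1" using aw ap by (auto simp: l_def field_simps)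
  have "q \<in> Q" unfolding q_def
    by (rule convexD_alt[OF convex]) (use w l pQ in \<open>auto simp: extreme_point_of_def\<close>)
  moreover have "a \<bullet> q = a \<bullet> w - l * (a \<bullet> w - a \<bullet> p)" by (simp add: q_def inner_simps algebra_simps)
  then have "a \<bullet> q = b" using aw ap by (simp add: l_def)
  ultimately have "q \<in> d" using Int_line by auto
  then have "b' \<le> a' \<bullet> q" using d by auto
  moreover have "a' \<bullet> q = b' - (1 - l) * (b' - a' \<bullet> w)" by (simp add: q_def inner_simps a'p algebra_simps)
  moreover have "(1 - l) * (b' - a' \<bullet> w) > 0" using l w(2) by simp
  ultimately show False by linarith
qed

lemma diagonal_cut_lo:
  assumes c: "diagonal_cut Q a' b' s t" and e: "closed_segment s t \<in> diagonals lo"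
  shows "diagonal_cut lo a' b' s t"
proof -
  interpret c: diagonal_cut Q a' b' s t by (rule c)
  obtain s' t' where st: "closed_segment s t = closed_segment s' t'" "s' extreme_point_of lo"
     "t' extreme_point_of lo" "s' \<noteq> t'" "\<not> closed_segment s' t' face_of lo"
    using e by (rule diagonalsE)
  \<comment> \<open>Diagonals are segments, so the ends delivered by \<open>diagonalsE\<close> agree
    with \<open>s\<close> and \<open>t\<close> only up to order.\<close>
  then have "{s, t} = {s', t'}" by simp
  then have "s extreme_point_of lo" "t extreme_point_of lo" using st by (auto simp: doubleton_eq_iff)
  moreover have "\<not> closed_segment s t face_of lo" unfolding st(1) by (rule st(5))
  ultimately show ?thesis
    using polytope_lo aff_dim_lo c.u_neq_v c.a_nz c.au c.av by (simp add: diagonal_cut_def)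
qed

end

text \<open>The diagonals that cut off a multiple of \<open>q\<close> vertices; with \<open>q = k - 2\<close> these are the
  \<open>k\<close>-allowable ones.\<close>

definition q_diagonal :: "nat \<Rightarrow> (real^2) set \<Rightarrow> (real^2) set \<Rightarrow> bool" where
  "q_diagonal q Q d \<longleftrightarrow> (\<exists>a b u v. diagonal_cut Q a b u v \<and> d = closed_segment u v \<and>
     q dvd card {w. w extreme_point_of Q \<and> a \<bullet> w < b})"

lemma q_diagonalI:
  "diagonal_cut Q a b u v \<Longrightarrow> q dvd card {w. w extreme_point_of Q \<and> a \<bullet> w < b} \<Longrightarrow>
    q_diagonal q Q (closed_segment u v)"
  unfolding q_diagonal_def by blast

text \<open>As \<open>d\<close> does not cross \<open>e\<close>, it lies on one side of
  \<open>e\<close>, and the vertices strictly on the other side are the same for \<open>lo\<close>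
  and \<open>Q\<close>. If the given count belongs to the side of \<open>d\<close>, divisibility is
  first carried across: both counts add up to \<open>num_vertices Q - 2\<close>.\<close>

lemma (in diagonal_cut) q_diagonal_lo:
  assumes e: "e \<in> diagonals lo" "q_diagonal q Q e" and q: "q dvd num_vertices Q - 2"
  shows "q_diagonal q lo e"
proof -
  obtain a' b' s t where c: "diagonal_cut Q a' b' s t" and st: "e = closed_segment s t"
    and dv: "q dvd card {w. w extreme_point_of Q \<and> a' \<bullet> w < b'}"
    using e(2) by (auto simp: q_diagonal_def)
  have *: "q_diagonal q lo e" if c: "diagonal_cut Q a' b' s t" and d: "d \<subseteq> {x. b' \<le> a' \<bullet> x}"
    and dv: "q dvd card {w. w extreme_point_of Q \<and> a' \<bullet> w < b'}" for a' b'
  proof -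
    have "{w. w extreme_point_of lo \<and> a' \<bullet> w < b'} = {w. w extreme_point_of Q \<and> a' \<bullet> w < b'}"
      using extreme_less_subset_lo[OF c] d e(1) st by (auto simp: extreme_lo_iff)
    then show ?thesis
      unfolding q_diagonal_def using diagonal_cut_lo[OF c] e(1) st dv
      by (intro exI[of _ a'] exI[of _ b'] exI[of _ s] exI[of _ t]) simp
  qed
  interpret c: diagonal_cut Q a' b' s t by (rule c)
  have "noncrossing d (closed_segment s t)"
    using noncrossing_d_lo[OF e(1)] st by (simp add: noncrossing_sym)
  then consider "d \<subseteq> {x. b' \<le> a' \<bullet> x}" | "d \<subseteq> {x. a' \<bullet> x \<le> b'}"
    using c.noncrossing_side[OF diagonal] by blast
  then show ?thesis
  proof cases
    case 1
    then show ?thesis using * c dv by blast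
  next
    case 2
    have "q dvd card {w. w extreme_point_of Q \<and> b' < a' \<bullet> w}"
      using q dv unfolding c.num_vertices_eq by (simp add: dvd_add_right_iff)
    then show ?thesis using 2 *[OF diagonal_cut_minus[OF c]] by simp
  qed
qed

section \<open>Counting the pieces of a dissection\<close>

text \<open>Induction along a cut at one member of \<open>X\<close>, which divides the other
  diagonals, the components and the vertices between the two sides. The truncated subtraction is
  exact at every cut, since \<open>u\<close> and \<open>v\<close> are vertices of both
  sides.\<close>

lemma dissection_count:
  assumes "polytope Q" "aff_dim Q = 2" "X \<subseteq> diagonals Q" "pairwise noncrossing X"
  shows "finite (components (interior Q - \<Union>X)) \<and> card (components (interior Q - \<Union>X)) = card X + 1 \<and>
    (\<Sum>R\<in>components (interior Q - \<Union>X). num_vertices (closure R) - 2) = num_vertices Q - 2"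
  using assms
proof (induction "card X" arbitrary: X Q rule: less_induct)
  case less
  show ?case
  proof (cases "X = {}")
    case True
    have "convex Q" "closed Q" using less by (auto simp: polytope_imp_convex polytope_imp_closed)
    then have ne: "interior Q \<noteq> {}" and cl: "closure (interior Q) = Q"
      using interior_nonempty_if_aff_dim_2[of Q] convex_closure_interior[of Q] less.prems by auto
    have "components (interior Q) = {interior Q}"
      using ne \<open>convex Q\<close> by (simp add: components_eq_sing_iff convex_connected)
    then show ?thesis using True cl by simp
  next
    case False
    then obtain d where d: "d \<in> X" by blast
    then obtain a b u v where c: "diagonal_cut Q a b u v" and duv: "d = closed_segment u v"
      using exists_diagonal_cut less.prems by blast
    interpret diagonal_cut Q a b u v by (rule c)
    define Y where "Y = X \<inter> diagonals lo"
    define Z where "Z = X \<inter> diagonals hi"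
    have split: "X = insert d (Y \<union> Z)"
      using diagonals_split[of X] less.prems d duv by (simp add: Y_def Z_def)
    have "finite X" using less.prems finite_diagonals finite_subset by blast
    have dYZ: "d \<notin> Y \<union> Z"
      using diagonals_lo_subset hi_facts(5) by (auto simp: Y_def Z_def duv)
    have "Y \<inter> Z = {}" using diagonals_lo_hi_disjoint by (auto simp: Y_def Z_def)
    moreover have "finite Y" "finite Z" using \<open>finite X\<close> by (auto simp: Y_def Z_def)
    ultimately have cX: "card X = card Y + card Z + 1"
      using dYZ by (subst split) (simp add: card_Un_disjoint)
    have pw: "pairwise noncrossing Y" "pairwise noncrossing Z"
      using less.prems(4) by (auto simp: Y_def Z_def intro: pairwise_subset)
    have sub: "Y \<subseteq> diagonals lo" "Z \<subseteq> diagonals hi" by (auto simp: Y_def Z_def)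
    note IHY = less.hyps[OF _ polytope_lo aff_dim_lo sub(1) pw(1)]
    note IHZ = less.hyps[OF _ hi_facts(1,2) sub(2) pw(2)]
    have cs: "components (interior Q - \<Union>X) =
        components (interior lo - \<Union>Y) \<union> components (interior hi - \<Union>Z)"
      by (subst split) (simp only: duv components_split(1)[OF sub])
    note dis = components_split(2)[OF sub]
    have Y: "finite (components (interior lo - \<Union>Y))"
      "card (components (interior lo - \<Union>Y)) = card Y + 1"
      "(\<Sum>R\<in>components (interior lo - \<Union>Y). num_vertices (closure R) - 2) = num_vertices lo - 2"
      using IHY cX by simp_all
    have Z: "finite (components (interior hi - \<Union>Z))"
      "card (components (interior hi - \<Union>Z)) = card Z + 1"
      "(\<Sum>R\<in>components (interior hi - \<Union>Z). num_vertices (closure R) - 2) = num_vertices hi - 2"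
      using IHZ cX by simp_all
    have "num_vertices hi = card {w. w extreme_point_of Q \<and> b < a \<bullet> w} + 2"
      using hi_facts(3) by simp
    then have "num_vertices lo - 2 + (num_vertices hi - 2) = num_vertices Q - 2"
      unfolding card_extreme_lo num_vertices_eq by simp
    then show ?thesis
      unfolding cs card_Un_disjoint[OF Y(1) Z(1) dis] sum.union_disjoint[OF Y(1) Z(1) dis] Y Z
      using cX Y(1) Z(1) by simp
  qed
qed

lemma card_dissection:
  assumes "polytope Q" "aff_dim Q = 2" "X \<in> dissections k m Q"
  shows "card X + 1 = m"
  using dissection_count[OF assms(1,2), of X] assms(3) by (auto simp: dissections_def)

text \<open>The members of \<open>X\<close> inside \<open>lo\<close> divide \<open>lo\<close> into
  some of the same \<open>k\<close>-gons, each contributing \<open>k - 2\<close> to the sum in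
  \<open>dissection_count\<close>. That sum is \<open>num_vertices lo - 2\<close>, the number of
  vertices strictly below the diagonal.\<close>

lemma q_diagonal_if_in_dissection:
  assumes "polytope Q" "aff_dim Q = 2" "X \<in> dissections k m Q" "d \<in> X"
  shows "q_diagonal (k - 2) Q d"
proof -
  have X: "X \<subseteq> diagonals Q" "pairwise noncrossing X"
    and gon: "\<And>R. R \<in> components (interior Q - \<Union>X) \<Longrightarrow> num_vertices (closure R) = k"
    using assms(3) by (auto simp: dissections_def convex_gon_def)
  obtain a b u v where c: "diagonal_cut Q a b u v" and duv: "d = closed_segment u v"
    using exists_diagonal_cut[OF assms(1,2)] X(1) assms(4) by blast
  interpret diagonal_cut Q a b u v by (rule c)
  define Y where "Y = X \<inter> diagonals lo"
  define Z where "Z = X \<inter> diagonals hi"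
  have split: "X = insert d (Y \<union> Z)"
    using diagonals_split[of X] X assms(4) duv by (simp add: Y_def Z_def)
  have sub: "Y \<subseteq> diagonals lo" "Z \<subseteq> diagonals hi" by (auto simp: Y_def Z_def)
  have "pairwise noncrossing Y" using X(2) by (auto simp: Y_def intro: pairwise_subset)
  then have "(\<Sum>R\<in>components (interior lo - \<Union>Y). num_vertices (closure R) - 2) = num_vertices lo - 2"
    using dissection_count[OF polytope_lo aff_dim_lo sub(1)] by blast
  moreover have "num_vertices (closure R) = k" if "R \<in> components (interior lo - \<Union>Y)" for R
  proof (rule gon)
    show "R \<in> components (interior Q - \<Union>X)"
      by (subst split) (simp only: duv components_split(1)[OF sub] Un_iff that simp_thms)
  qed
  ultimately have "num_vertices lo - 2 = card (components (interior lo - \<Union>Y)) * (k - 2)"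
    by (simp del: interior_Int)
  then have "k - 2 dvd card {w. w extreme_point_of Q \<and> a \<bullet> w < b}"
    unfolding card_extreme_lo by simp
  then show ?thesis using c duv by (auto simp: q_diagonal_def)
qed

lemma (in diagonal_cut) dissection_combine:
  assumes X: "X \<in> dissections k m lo" and Y: "Y \<in> dissections k n hi"
  shows "insert d (X \<union> Y) \<in> dissections k (m + n) Q"
proof -
  have sub: "X \<subseteq> diagonals lo" "Y \<subseteq> diagonals hi" using X Y by (auto simp: dissections_def)
  have fin: "finite (components (interior lo - \<Union>X))" "finite (components (interior hi - \<Union>Y))"
    using dissection_count[OF polytope_lo aff_dim_lo, of X]
      dissection_count[OF hi_facts(1,2), of Y] X Y by (auto simp: dissections_def)
  have "noncrossing e f" if "e \<in> insert d (X \<union> Y)" "f \<in> insert d (X \<union> Y)" "e \<noteq> f" for e f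
  proof -
    have "noncrossing e d" if "e \<in> X \<union> Y" for e
      using that sub noncrossing_d_lo diagonal_cut.noncrossing_d_lo[OF diagonal_cut_minus[OF diagonal_cut_axioms]] by blast
    moreover have "noncrossing e f" if "e \<in> X" "f \<in> Y" for e f
      using that sub noncrossing_lo_hi by blast
    moreover have "pairwise noncrossing X" "pairwise noncrossing Y"
      using X Y by (auto simp: dissections_def)
    ultimately show ?thesis
      using that unfolding pairwise_def by (metis Un_iff insert_iff noncrossing_sym)
  qed
  then have "pairwise noncrossing (insert d (X \<union> Y))" by (auto simp: pairwise_def)
  moreover have "insert d (X \<union> Y) \<subseteq> diagonals Q"
    using sub diagonals_lo_subset hi_facts(5) diagonal by auto
  ultimately show ?thesis
    using X Y unfolding dissections_def mem_Collect_eq components_split(1)[OF sub]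
    unfolding card_Un_disjoint[OF fin components_split(2)[OF sub]] by blast
qed

section \<open>Existence of cuts, and extension to dissections\<close>

text \<open>Removing the maximum leaves the ranks of the other elements unchanged, which carries the
  induction.\<close>

lemma exists_card_less:
  fixes A :: "real set"
  assumes "finite A" "j < card A"
  shows "\<exists>x\<in>A. card {y\<in>A. y < x} = j"
  using assms
proof (induction "card A" arbitrary: A)
  case (Suc n)
  then have ne: "A \<noteq> {}" by auto
  define M where "M = Max A"
  have M: "M \<in> A" "\<And>y. y \<in> A \<Longrightarrow> y \<le> M" using Suc ne by (auto simp: M_def)
  have c: "card (A - {M}) = n" using Suc M by simp
  show ?case
  proof (cases "j = n")
    case True
    have "{y\<in>A. y < M} = A - {M}" using M(2) by (force simp: order.order_iff_strict)
    then have "card {y\<in>A. y < M} = j" using c True by simp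
    then show ?thesis using M(1) by blast
  next
    case False
    then obtain x where x: "x \<in> A - {M}" "card {y\<in>A - {M}. y < x} = j"
      using Suc.hyps(1)[of "A - {M}"] Suc c by auto
    have "{y\<in>A - {M}. y < x} = {y\<in>A. y < x}" using x(1) M(2)[of x] by auto
    then show ?thesis using x by auto
  qed
qed simp

text \<open>A vertex \<open>u\<close> is strictly separated from the hull of the other vertices, so
  these are seen from \<open>u\<close> within an open half-plane and can be ordered by slope. No two
  slopes coincide, because a line through two vertices contains no third one. The vertex of rank
  \<open>j\<close> is the other end of the cut; the bounds on \<open>j\<close> keep vertices on both
  sides.\<close>

lemma exists_cut:
  fixes Q :: "(real^2) set"
  assumes Q: "polytope Q" "aff_dim Q = 2" and j: "1 \<le> j" "j + 3 \<le> num_vertices Q"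
  shows "\<exists>a b u v. diagonal_cut Q a b u v \<and> card {w. w extreme_point_of Q \<and> a \<bullet> w < b} = j"
proof -
  let ?V = "{v. v extreme_point_of Q}"
  have cQ: "convex Q" using Q by (simp add: polytope_imp_convex)
  have fin: "finite ?V"
    using Q by (simp add: finite_polyhedron_extreme_points polytope_imp_polyhedron)
  then obtain u where u: "u \<in> ?V" using j by fastforce
  have VQ: "?V \<subseteq> Q" by (auto simp: extreme_point_of_def)
  have "u \<notin> convex hull (?V - {u})"
  proof -
    have "convex hull (?V - {u}) \<subseteq> Q - {u}"
      by (rule hull_minimal) (use u VQ extreme_point_of_stillconvex[OF cQ] in auto)
    then show ?thesis by blast
  qed
  moreover have "closed (convex hull (?V - {u}))"
    using fin by (simp add: compact_convex_hull finite_imp_compact compact_imp_closed)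
  ultimately obtain c e where ce: "c \<bullet> u < e" "\<And>x. x \<in> convex hull (?V - {u}) \<Longrightarrow> c \<bullet> x > e"
    using separating_hyperplane_closed_point[of "convex hull (?V - {u})" u] by auto
  have pos: "c \<bullet> (w - u) > 0" if "w \<in> ?V - {u}" for w
    using ce(2)[OF hull_inc[OF that]] ce(1) by (simp add: inner_diff_right)
  \<comment> \<open>Slopes are taken in the frame of \<open>c\<close> and \<open>rot c\<close>. The
    vector \<open>N s\<close> is normal to the line of slope \<open>s\<close>, so for
    \<open>w\<close> in the open half-plane the sign of \<open>N s \<bullet> (w - u)\<close>
    compares \<open>slope w\<close> with \<open>s\<close>.\<close>
  define slope where "slope w = (rot c \<bullet> (w - u)) / (c \<bullet> (w - u))" for w
  define N where "N s = rot c - s *\<^sub>R c" for s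
  have N: "N s \<bullet> (w - u) = (c \<bullet> (w - u)) * (slope w - s)" if "w \<in> ?V - {u}" for w s
    using pos[OF that] unfolding N_def slope_def inner_diff_left inner_scaleR_left by (simp add: field_simps)
  have cV: "card (?V - {u}) = num_vertices Q - 1" using u fin by simp
  then have "card (?V - {u}) > 0" using j by linarith
  then have "?V - {u} \<noteq> {}" by (auto simp only: card.empty)
  then have cnz: "c \<noteq> 0" using pos by force
  have Nnz: "N s \<noteq> 0" for s
  proof
    assume "N s = 0"
    then have "N s \<bullet> rot c = 0" by simp
    moreover have "c \<bullet> rot c = 0" using rot_inner_self[of c] by (simp add: inner_commute)
    ultimately show False using cnz by (simp add: N_def inner_diff_left)
  qed
  have inj: "inj_on slope (?V - {u})"
  proof (rule inj_onI)
    fix w v assume wv: "w \<in> ?V - {u}" "v \<in> ?V - {u}" "slope w = slope v"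
    let ?a = "N (slope v)"
    have "?a \<bullet> v = ?a \<bullet> u" "?a \<bullet> w = ?a \<bullet> u"
      using N[OF wv(1), of "slope v"] N[OF wv(2), of "slope v"] wv(3) by (simp_all add: inner_diff_right)
    then have "w \<in> Q \<inter> {x. ?a \<bullet> x = ?a \<bullet> u}" using wv VQ by auto
    also have "\<dots> = closed_segment u v"
      by (rule Int_line_eq_segment[OF cQ Nnz]) (use u wv \<open>?a \<bullet> v = ?a \<bullet> u\<close> in auto)
    finally show "w = v" using wv u by (auto simp: extreme_point_of_def open_segment_def)
  qed
  have "card (slope ` (?V - {u})) = num_vertices Q - 1" using cV inj by (simp add: card_image)
  then obtain v where v: "v \<in> ?V - {u}" and cv: "card {y \<in> slope ` (?V - {u}). y < slope v} = j"
    using exists_card_less[of "slope ` (?V - {u})" j] fin j by fastforce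
  let ?a = "N (slope v)" and ?b = "N (slope v) \<bullet> u"
  have av: "?a \<bullet> v = ?b" using N[OF v, of "slope v"] by (simp add: inner_diff_right)
  have less: "?a \<bullet> w < ?b \<longleftrightarrow> slope w < slope v" if "w \<in> ?V - {u}" for w
    using N[OF that, of "slope v"] pos[OF that]
    by (simp add: inner_diff_right) (smt (verit) mult_less_0_iff zero_less_mult_iff mult_eq_0_iff)
  have L: "{w. w extreme_point_of Q \<and> ?a \<bullet> w < ?b} = {w \<in> ?V - {u}. slope w < slope v}"
    using less by fastforce
  have "{y \<in> slope ` (?V - {u}). y < slope v} = slope ` {w \<in> ?V - {u}. slope w < slope v}" by auto
  moreover have "inj_on slope {w \<in> ?V - {u}. slope w < slope v}"
    using inj by (rule inj_on_subset) auto
  ultimately have cL: "card {w. w extreme_point_of Q \<and> ?a \<bullet> w < ?b} = j"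
    using cv unfolding L by (simp only: card_image)
  obtain w1 where w1: "w1 \<in> ?V" "?a \<bullet> w1 < ?b" 
  proof -
    have "card {w. w extreme_point_of Q \<and> ?a \<bullet> w < ?b} \<noteq> 0" unfolding cL using j(1) by simp
    then have "{w. w extreme_point_of Q \<and> ?a \<bullet> w < ?b} \<noteq> {}" by (rule contrapos_nn) (simp only: card.empty)
    then show thesis using that by blast
  qed
  \<comment> \<open>The vertices below the line together with \<open>u\<close> and \<open>v\<close>
    number at most \<open>j + 2\<close>, so one vertex remains strictly above.\<close>
  obtain w2 where w2: "w2 \<in> ?V" "?b < ?a \<bullet> w2"
  proof -
    have "\<not> ?V \<subseteq> {w. w extreme_point_of Q \<and> ?a \<bullet> w < ?b} \<union> {u, v}"
    proof
      assume "?V \<subseteq> {w. w extreme_point_of Q \<and> ?a \<bullet> w < ?b} \<union> {u, v}"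
      then have "num_vertices Q \<le> card ({w. w extreme_point_of Q \<and> ?a \<bullet> w < ?b} \<union> {u, v})"
        by (rule card_mono[rotated]) (use fin in \<open>auto intro: finite_subset[rotated]\<close>)
      also have "\<dots> \<le> j + 2"
        using card_Un_le[of "{w. w extreme_point_of Q \<and> ?a \<bullet> w < ?b}" "{u, v}"] cL
          card_insert_le_m1[of 2 "{v}" u] by simp
      finally show False using j by simp
    qed
    then obtain w where w: "w \<in> ?V" "w \<noteq> u" "w \<noteq> v" "\<not> ?a \<bullet> w < ?b" by blast
    moreover have "slope w \<noteq> slope v" using inj w v by (auto dest: inj_onD)
    then have "?a \<bullet> w \<noteq> ?b"
      using N[of w "slope v"] pos[of w] w by (auto simp: inner_diff_right)
    ultimately show thesis using that by force
  qed
  \<comment> \<open>The segment from \<open>w1\<close> to \<open>w2\<close> meets the line in a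
    point of \<open>closed_segment u v\<close>; a face containing this inner point would have to
    contain \<open>w1\<close>.\<close>
  have "\<not> closed_segment u v face_of Q"
  proof
    assume f: "closed_segment u v face_of Q"
    define l where "l = (?b - ?a \<bullet> w1) / (?a \<bullet> w2 - ?a \<bullet> w1)"
    define q where "q = (1 - l) *\<^sub>R w1 + l *\<^sub>R w2"
    have l: "0 < l" "l < 1" using w1 w2 by (auto simp: l_def field_simps)
    have "w1 \<noteq> w2" using w1 w2 by auto
    then have qo: "q \<in> open_segment w1 w2" using l by (auto simp: in_segment q_def)
    have "q \<in> Q" unfolding q_def
      by (rule convexD_alt[OF cQ]) (use w1 w2 VQ l in auto)
    have "?a \<bullet> q = ?a \<bullet> w1 + l * (?a \<bullet> w2 - ?a \<bullet> w1)" by (simp add: q_def inner_simps algebra_simps)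
    also have "\<dots> = ?b" using w1 w2 by (simp add: l_def)
    finally have "q \<in> Q \<inter> {x. ?a \<bullet> x = ?b}" using \<open>q \<in> Q\<close> by simp
    also have seg: "\<dots> = closed_segment u v"
      by (rule Int_line_eq_segment[OF cQ Nnz]) (use u v av in auto)
    finally have "w1 \<in> closed_segment u v"
      using f qo w1 w2 VQ unfolding face_of_def by blast
    then show False using w1(2) unfolding seg[symmetric] by simp
  qed
  then have "diagonal_cut Q ?a ?b u v" using Q u v av Nnz by (auto simp: diagonal_cut_def)
  then show ?thesis using cL by blast
qed

text \<open>A cut along a member of \<open>S\<close> leaves two smaller polygons of the same kind,
  in which the remaining diagonals keep their divisibility by \<open>q_diagonal_lo\<close>;
  dissections of both sides combine. An empty \<open>S\<close> is first enlarged by a diagonal that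
  cuts off a single \<open>k\<close>-gon, unless \<open>Q\<close> is itself a
  \<open>k\<close>-gon.\<close>

lemma q_diagonals_extend:
  assumes "3 \<le> k" "1 \<le> m" "convex_gon (m * (k - 2) + 2) Q" "S \<subseteq> diagonals Q" "pairwise noncrossing S"
    "\<And>d. d \<in> S \<Longrightarrow> q_diagonal (k - 2) Q d"
  shows "\<exists>X \<in> dissections k m Q. S \<subseteq> X"
  using assms
proof (induction m arbitrary: Q S rule: less_induct)
  case (less m)
  define q where "q = k - 2"
  have q: "q \<ge> 1" using less.prems by (simp add: q_def)
  have Q: "polytope Q" "aff_dim Q = 2" and nQ: "num_vertices Q = m * q + 2"
    using less.prems(3) by (auto simp: convex_gon_def q_def)
  \<comment> \<open>Proved for an arbitrary nonempty set at the current \<open>m\<close>, since the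
    case of an empty \<open>S\<close> falls back on it with a singleton.\<close>
  have ne: "\<exists>X \<in> dissections k m Q. S \<subseteq> X"
    if S: "S \<subseteq> diagonals Q" "pairwise noncrossing S" "\<And>d. d \<in> S \<Longrightarrow> q_diagonal q Q d" "S \<noteq> {}" for S
  proof -
    obtain d where d: "d \<in> S" using S by blast
    then obtain a b u v where c: "diagonal_cut Q a b u v" and duv: "d = closed_segment u v"
      and dv: "q dvd card {w. w extreme_point_of Q \<and> a \<bullet> w < b}"
      using S(3)[OF d] unfolding q_diagonal_def by blast
    interpret diagonal_cut Q a b u v by (rule c)
    interpret flip: diagonal_cut Q "-a" "-b" u v by (rule diagonal_cut_minus[OF c])
    have "q dvd card {w. w extreme_point_of Q \<and> b < a \<bullet> w}"
    proof -
      have "card {w. w extreme_point_of Q \<and> a \<bullet> w < b} + card {w. w extreme_point_of Q \<and> b < a \<bullet> w} = m * q"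
        using nQ num_vertices_eq by simp
      then have "q dvd card {w. w extreme_point_of Q \<and> a \<bullet> w < b} +
          card {w. w extreme_point_of Q \<and> b < a \<bullet> w}" by simp
      then show ?thesis unfolding dvd_add_right_iff[OF dv] .
    qed
    then obtain m1 m2 where m1: "card {w. w extreme_point_of Q \<and> a \<bullet> w < b} = m1 * q"
      and m2: "card {w. w extreme_point_of Q \<and> b < a \<bullet> w} = m2 * q"
      using dv by (auto simp: dvd_def mult.commute)
    have "m = m1 + m2" using num_vertices_eq nQ m1 m2 q by (simp flip: distrib_right)
    \<comment> \<open>Each side of a cut contains a vertex off the line. Hence both
      \<open>m1\<close> and \<open>m2\<close> are positive, and so both are smaller than
      \<open>m\<close>.\<close>
    moreover have "m1 > 0" using card_extreme_less_pos m1 by simp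
    moreover have "m2 > 0" using flip.card_extreme_less_pos m2 by simp
    ultimately have m: "m1 < m" "1 \<le> m1" "m2 < m" "1 \<le> m2" "m = m1 + m2" by auto
    have gon: "convex_gon (m1 * (k - 2) + 2) lo" "convex_gon (m2 * (k - 2) + 2) hi"
      using polytope_lo aff_dim_lo card_extreme_lo flip.polytope_lo flip.aff_dim_lo flip.card_extreme_lo m1 m2
      by (simp_all add: convex_gon_def q_def)
    have dq: "q dvd num_vertices Q - 2" using nQ by simp
    have "\<exists>X \<in> dissections k m1 lo. S \<inter> diagonals lo \<subseteq> X"
      by (rule less.IH[OF m(1) less.prems(1) m(2) gon(1)])
        (use S q_diagonal_lo[OF _ _ dq] in \<open>auto simp: q_def intro: pairwise_subset\<close>)
    then obtain X where X: "X \<in> dissections k m1 lo" "S \<inter> diagonals lo \<subseteq> X" by blast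
    have "\<exists>X \<in> dissections k m2 hi. S \<inter> diagonals hi \<subseteq> X"
    proof (rule less.IH[OF m(3) less.prems(1) m(4) gon(2)])
      show "pairwise noncrossing (S \<inter> diagonals hi)" using S(2) by (rule pairwise_subset) blast
      show "q_diagonal (k - 2) hi e" if "e \<in> S \<inter> diagonals hi" for e
        using flip.q_diagonal_lo[of e q] that S(3) dq unfolding q_def by blast
    qed blast
    then obtain Y where Y: "Y \<in> dissections k m2 hi" "S \<inter> diagonals hi \<subseteq> Y" by blast
    have "S = insert d (S \<inter> diagonals lo \<union> S \<inter> diagonals hi)"
      using diagonals_split[of S] S d duv by simp
    then have "S \<subseteq> insert d (X \<union> Y)" using X(2) Y(2) by blast
    then show ?thesis using dissection_combine[OF X(1) Y(1)] m(5) duv by blast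
  qed
  show ?case
  proof (cases "S = {}")
    case False
    then show ?thesis using ne[of S] less.prems q_def by blast
  next
    case S: True
    show ?thesis
    proof (cases "m = 1")
      case True
      have "convex Q" "closed Q" using Q by (auto simp: polytope_imp_convex polytope_imp_closed)
      then have ne: "interior Q \<noteq> {}" and cl: "closure (interior Q) = Q"
        using interior_nonempty_if_aff_dim_2[of Q] convex_closure_interior[of Q] Q by auto
      have "components (interior Q) = {interior Q}"
        using ne \<open>convex Q\<close> by (simp add: components_eq_sing_iff convex_connected)
      moreover have "m * (k - 2) + 2 = k" using less.prems(1) True by simp
      then have "convex_gon k Q" using less.prems(3) by (simp only:)
      ultimately have "{} \<in> dissections k m Q"
        using True cl by (simp add: dissections_def)
      then show ?thesis using S by blast
    next
      case False
      \<comment> \<open>With \<open>m \<ge> 2\<close> there are at least \<open>2 * q + 2\<close>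
        vertices, and \<open>q \<ge> 1\<close> makes this at least \<open>q + 3\<close>, as
        \<open>exists_cut\<close> requires for cutting off \<open>q\<close> of them.\<close>
      then have "2 * q \<le> m * q" using less.prems(2) by simp
      then have "q + 3 \<le> num_vertices Q" using nQ q by linarith
      then obtain a b u v where c: "diagonal_cut Q a b u v" "card {w. w extreme_point_of Q \<and> a \<bullet> w < b} = q"
        using exists_cut[OF Q q] by blast
      have "q_diagonal q Q (closed_segment u v)"
        by (rule q_diagonalI[OF c(1)]) (simp add: c(2))
      then show ?thesis
        using ne[of "{closed_segment u v}"] diagonal_cut.diagonal[OF c(1)] S by auto
    qed
  qed
qed

lemma finite_allowable: "polytope Q \<Longrightarrow> finite (allowable k m Q)"
  by (rule finite_subset[OF _ finite_diagonals[of Q]]) (auto simp: allowable_def dissections_def)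

lemma noncrossing_allowable_extend:
  assumes "3 \<le> k" "1 \<le> m" "convex_gon (m * (k - 2) + 2) Q" "S \<subseteq> allowable k m Q" "pairwise noncrossing S"
  shows "\<exists>X \<in> dissections k m Q. S \<subseteq> X"
proof (rule q_diagonals_extend[OF assms(1-3) _ assms(5)])
  show "S \<subseteq> diagonals Q" using assms(4) by (auto simp: allowable_def dissections_def)
  show "q_diagonal (k - 2) Q d" if d: "d \<in> S" for d
  proof -
    obtain X where "X \<in> dissections k m Q" "d \<in> X"
      using d assms(4) by (auto simp: allowable_def)
    then show ?thesis using assms(3) by (auto simp: convex_gon_def intro: q_diagonal_if_in_dissection)
  qed
qed

text \<open>A noncrossing set of allowable diagonals extends to a dissection, and every dissection
  has \<open>m - 1\<close> diagonals; a set of that size therefore equals its extension.\<close>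

lemma dissections_iff:
  assumes "3 \<le> k" "1 \<le> m" "convex_gon (m * (k - 2) + 2) Q"
  shows "X \<in> dissections k m Q \<longleftrightarrow> X \<subseteq> allowable k m Q \<and> pairwise noncrossing X \<and> card X = m - 1"
proof
  assume X: "X \<in> dissections k m Q"
  then have "card X + 1 = m" using card_dissection assms(3) by (auto simp: convex_gon_def)
  then show "X \<subseteq> allowable k m Q \<and> pairwise noncrossing X \<and> card X = m - 1"
    using X by (auto simp: allowable_def dissections_def)
next
  assume X: "X \<subseteq> allowable k m Q \<and> pairwise noncrossing X \<and> card X = m - 1"
  then obtain Y where Y: "Y \<in> dissections k m Q" "X \<subseteq> Y"
    using noncrossing_allowable_extend[OF assms] by blast
  have Q: "polytope Q" "aff_dim Q = 2" using assms(3) by (auto simp: convex_gon_def)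
  then have "card Y + 1 = m" using card_dissection Y(1) by blast
  moreover have "finite Y"
    using Y(1) Q(1) finite_diagonals by (auto simp: dissections_def intro: finite_subset)
  ultimately have "X = Y" using X Y(2) by (metis add_diff_cancel_right' card_subset_eq)
  then show "X \<in> dissections k m Q" using Y(1) by simp
qed

section \<open>Simplices and cells in coordinates\<close>

lemma lookup_scaleR [simp]:
  "Poly_Mapping.lookup (r *\<^sub>R x) i = r *\<^sub>R Poly_Mapping.lookup x i"
proof -
  have "finite {i. r *\<^sub>R Poly_Mapping.lookup x i \<noteq> 0}"
    by (rule finite_subset[OF _ finite_keys[of x]]) (auto simp: in_keys_iff)
  then show ?thesis by (simp add: scaleR_poly_mapping_def)
qed

lemma lookup_unit_vec: "Poly_Mapping.lookup (unit_vec d) e = (if d = e then 1 else 0)"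
  by (simp add: unit_vec_def lookup_single when_def)

lemma keys_subset_iff: "Poly_Mapping.keys x \<subseteq> A \<longleftrightarrow> (\<forall>d. d \<notin> A \<longrightarrow> Poly_Mapping.lookup x d = 0)"
  by (auto simp: in_keys_iff)

text \<open>The simplices \<open>face S\<close> and the cells of \<open>D(k,m)\<close> are both of the following form, with \<open>L\<close>
  prescribing some coordinate sums. Their faces are obtained by shrinking \<open>A\<close>.\<close>

definition slice :: "'a set \<Rightarrow> ('a \<Rightarrow>\<^sub>0 real) set \<Rightarrow> ('a \<Rightarrow>\<^sub>0 real) set" where
  "slice A L = {x. Poly_Mapping.keys x \<subseteq> A \<and> (\<forall>d. 0 \<le> Poly_Mapping.lookup x d) \<and> x \<in> L}"

lemma convex_slice:
  assumes "affine L"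
  shows "convex (slice A L)"
proof (rule convexI)
  fix x y :: "'a \<Rightarrow>\<^sub>0 real" and s t :: real
  assume xy: "x \<in> slice A L" "y \<in> slice A L" and st: "0 \<le> s" "0 \<le> t" "s + t = 1"
  then have "s *\<^sub>R x + t *\<^sub>R y \<in> L" using assms by (auto simp: slice_def affine_def)
  then show "s *\<^sub>R x + t *\<^sub>R y \<in> slice A L"
    using xy st by (simp add: slice_def keys_subset_iff lookup_add)
qed

lemma slice_Int: "slice A L \<inter> slice B L = slice (A \<inter> B) L"
  by (auto simp: slice_def)

text \<open>A coordinate that vanishes strictly inside a segment of nonnegative points vanishes at
  both ends.\<close>

lemma slice_face_of_slice:
  assumes "affine L" "B \<subseteq> A"
  shows "slice B L face_of slice A L"
  unfolding face_of_def
proof (intro conjI ballI impI)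
  show "slice B L \<subseteq> slice A L" using assms(2) by (auto simp: slice_def)
  show "convex (slice B L)" by (rule convex_slice[OF assms(1)])
  fix x y z assume xy: "x \<in> slice A L" "y \<in> slice A L" and z: "z \<in> slice B L" "z \<in> open_segment x y"
  obtain t where t: "0 < t" "t < 1" "z = (1 - t) *\<^sub>R x + t *\<^sub>R y"
    using z(2) by (auto simp: in_segment)
  have 0: "Poly_Mapping.lookup x d = 0 \<and> Poly_Mapping.lookup y d = 0" if "d \<notin> B" for d
  proof -
    have "(1 - t) * Poly_Mapping.lookup x d + t * Poly_Mapping.lookup y d = 0"
      using z(1) that t(3) by (auto simp: slice_def keys_subset_iff lookup_add)
    moreover have "(1 - t) * Poly_Mapping.lookup x d \<ge> 0" "t * Poly_Mapping.lookup y d \<ge> 0"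
      using xy t by (auto simp: slice_def)
    ultimately have "(1 - t) * Poly_Mapping.lookup x d = 0" "t * Poly_Mapping.lookup y d = 0" by linarith+
    then show ?thesis using t by simp
  qed
  then show "x \<in> slice B L" "y \<in> slice B L"
    using xy by (auto simp: slice_def keys_subset_iff)
qed

text \<open>\<open>W\<close> is the union of the supports of the points of \<open>F\<close>. An
  average yields a point \<open>z\<close> of \<open>F\<close> that is positive on all of
  \<open>W\<close>, so a segment from any \<open>y\<close> in the slice over \<open>W\<close> to
  \<open>z\<close> can be prolonged within the slice, and the defining property of a face then puts
  \<open>y\<close> into \<open>F\<close>.\<close>

lemma face_of_sliceE:
  assumes "finite A" and L: "affine L" and F: "F face_of slice A L" "F \<noteq> {}"
  obtains W where "W \<subseteq> A" "F = slice W L"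
proof
  define W where "W = (\<Union>x\<in>F. Poly_Mapping.keys x)"
  have FA: "F \<subseteq> slice A L" and "convex F"
    using F(1) by (auto simp: face_of_imp_subset face_of_imp_convex)
  show W: "W \<subseteq> A" using FA by (auto simp: W_def slice_def)
  then have finW: "finite W" using assms(1) finite_subset by blast
  have "\<exists>z\<in>F. \<forall>w\<in>W. 0 < Poly_Mapping.lookup z w"
  proof (cases "W = {}")
    case True
    then show ?thesis using F(2) by auto
  next
    case False
    have "\<exists>x. x \<in> F \<and> w \<in> Poly_Mapping.keys x" if "w \<in> W" for w using that by (auto simp: W_def)
    then obtain x where x: "\<And>w. w \<in> W \<Longrightarrow> x w \<in> F" "\<And>w. w \<in> W \<Longrightarrow> w \<in> Poly_Mapping.keys (x w)"
      by metis
    define z where "z = (\<Sum>w\<in>W. (1 / real (card W)) *\<^sub>R x w)"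
    have "z \<in> F" unfolding z_def
      by (rule convex_sum[OF finW \<open>convex F\<close>]) (use x False finW in auto)
    moreover have "0 < Poly_Mapping.lookup z w" if w: "w \<in> W" for w
    proof -
      have nn: "0 \<le> Poly_Mapping.lookup (x v) w" if "v \<in> W" for v
        using x(1)[OF that] FA by (auto simp: slice_def)
      have "Poly_Mapping.lookup (x w) w > 0"
        using nn[OF w] x(2)[OF w] by (simp add: in_keys_iff)
      then have "(\<Sum>v\<in>W. (1 / real (card W)) * Poly_Mapping.lookup (x v) w) > 0"
        by (intro sum_pos2[OF finW w]) (use False finW nn in \<open>auto simp: card_gt_0_iff\<close>)
      then show ?thesis by (simp add: z_def lookup_sum)
    qed
    ultimately show ?thesis by blast
  qed
  then obtain z where z: "z \<in> F" "\<And>w. w \<in> W \<Longrightarrow> 0 < Poly_Mapping.lookup z w" by blast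
  have zW: "z \<in> slice W L" using z(1) FA by (auto simp: W_def slice_def)
  show "F = slice W L"
  proof
    show "F \<subseteq> slice W L" using FA by (auto simp: W_def slice_def)
    show "slice W L \<subseteq> F"
    proof
      fix y assume y: "y \<in> slice W L"
      show "y \<in> F"
      proof (cases "y = z")
        case False
        have "\<exists>e>0. \<forall>w\<in>W. e * Poly_Mapping.lookup y w \<le> Poly_Mapping.lookup z w"
        proof -
          \<comment> \<open>The \<open>1\<close> in the denominator keeps it positive where
            \<open>y\<close> vanishes; the inserted \<open>1\<close> covers an empty
            \<open>W\<close>.\<close>
          define e where "e = Min (insert 1 ((\<lambda>w. Poly_Mapping.lookup z w / (Poly_Mapping.lookup y w + 1)) ` W))"
          have yn: "0 \<le> Poly_Mapping.lookup y w" for w using y by (simp add: slice_def)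
          have "e > 0" using finW z(2) yn by (auto simp: e_def divide_pos_pos add_nonneg_pos)
          moreover have "e * Poly_Mapping.lookup y w \<le> Poly_Mapping.lookup z w" if w: "w \<in> W" for w
          proof -
            have "e \<le> Poly_Mapping.lookup z w / (Poly_Mapping.lookup y w + 1)"
              using finW w by (simp add: e_def)
            then have "e * (Poly_Mapping.lookup y w + 1) \<le> Poly_Mapping.lookup z w"
              using yn[of w] by (simp add: pos_le_divide_eq)
            then show ?thesis using \<open>e > 0\<close> by (simp add: distrib_left)
          qed
          ultimately show ?thesis by blast
        qed
        then obtain e where e: "e > 0" "\<And>w. w \<in> W \<Longrightarrow> e * Poly_Mapping.lookup y w \<le> Poly_Mapping.lookup z w"
          by blast
        \<comment> \<open>This is \<open>z + e *\<^sub>R (z - y)\<close>, the prolongation beyond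
          \<open>z\<close>; the choice of \<open>e\<close> keeps its coordinates
          nonnegative.\<close>
        define z' where "z' = (1 + e) *\<^sub>R z + (- e) *\<^sub>R y"
        have "z' \<in> L" unfolding z'_def by (rule mem_affine[OF L]) (use zW y in \<open>auto simp: slice_def\<close>)
        moreover have "0 \<le> Poly_Mapping.lookup z' w" for w
        proof (cases "w \<in> W")
          case True
          have "e * Poly_Mapping.lookup z w > 0" using e(1) z(2)[OF True] by simp
          then show ?thesis using e(2)[OF True] z(2)[OF True] by (simp add: z'_def lookup_add lookup_minus distrib_right)
        next
          case False
          then show ?thesis using zW y by (simp add: z'_def lookup_add lookup_minus slice_def keys_subset_iff)
        qed
        moreover have "Poly_Mapping.keys z' \<subseteq> W"
          using zW y by (simp add: z'_def lookup_add lookup_minus slice_def keys_subset_iff)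
        ultimately have z': "z' \<in> slice W L" by (simp add: slice_def)
        have "z \<in> open_segment y z'"
        proof -
          define t where "t = 1 / (1 + e)"
          have t: "0 < t" "t < 1" using e by (auto simp: t_def)
          have "(1 - t) = t * e" using e by (simp add: t_def field_simps)
          then have "(1 - t) *\<^sub>R y + t *\<^sub>R z' = (t * (1 + e)) *\<^sub>R z"
            by (simp add: z'_def scaleR_right_diff_distrib)
          also have "t * (1 + e) = 1" using e by (simp add: t_def)
          finally have "z = (1 - t) *\<^sub>R y + t *\<^sub>R z'" by simp
          moreover have "y \<noteq> z'"
          proof
            assume "y = z'"
            then have "z = y" using calculation by (simp add: algebra_simps flip: scaleR_add_left)
            then show False using False by simp
          qed
          ultimately show ?thesis using t by (auto simp: in_segment)
        qed
        moreover have "y \<in> slice A L" "z' \<in> slice A L" using y z' W by (auto simp: slice_def)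
        ultimately show ?thesis using F(1) z(1) unfolding face_of_def by blast
      qed (use z in simp)
    qed
  qed
qed

text \<open>The affine conditions that serve as \<open>L\<close> in a slice. A single block with
  \<open>c = 1\<close> gives the hyperplane of a standard simplex, and \<open>c = 1 / real g\<close>
  gives the cells of the projected product complex.\<close>

definition masses :: "nat \<Rightarrow> (nat \<Rightarrow> 'a set) \<Rightarrow> real \<Rightarrow> ('a \<Rightarrow>\<^sub>0 real) set" where
  "masses g \<sigma> c = {x. \<forall>i<g. (\<Sum>d\<in>\<sigma> i. Poly_Mapping.lookup x d) = c}"

lemma affine_masses: "affine (masses g \<sigma> c)"
  by (auto simp: affine_def masses_def lookup_add sum.distrib simp flip: sum_distrib_left distrib_right)

lemma sum_unit_vec:
  assumes "finite S" "Poly_Mapping.keys x \<subseteq> S"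
  shows "(\<Sum>d\<in>S. Poly_Mapping.lookup x d *\<^sub>R unit_vec d) = x"
proof (rule poly_mapping_eqI)
  fix e
  have "Poly_Mapping.lookup (\<Sum>d\<in>S. Poly_Mapping.lookup x d *\<^sub>R unit_vec d) e
      = (\<Sum>d\<in>S. if d = e then Poly_Mapping.lookup x d else 0)"
    by (simp add: lookup_sum lookup_unit_vec if_distrib cong: if_cong)
  then show "Poly_Mapping.lookup (\<Sum>d\<in>S. Poly_Mapping.lookup x d *\<^sub>R unit_vec d) e = Poly_Mapping.lookup x e"
    using assms by (auto simp: sum.delta keys_subset_iff)
qed

text \<open>The sum extends over the fixed set \<open>V\<close> instead of \<open>S\<close>, so that
  all simplices on subsets of \<open>V\<close> are slices of one affine set and
  \<open>slice_Int\<close> applies to them.\<close>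

lemma face_eq_slice:
  assumes "finite V" "S \<subseteq> V"
  shows "face S = slice S (masses 1 (\<lambda>_. V) 1)"
proof
  have "unit_vec d \<in> slice S (masses 1 (\<lambda>_. V) 1)" if "d \<in> S" for d
    using assms that by (auto simp: slice_def masses_def unit_vec_def[of d, THEN arg_cong[where f = Poly_Mapping.keys]] lookup_unit_vec)
  then show "face S \<subseteq> slice S (masses 1 (\<lambda>_. V) 1)"
    unfolding face_def by (intro hull_minimal convex_slice affine_masses) auto
  show "slice S (masses 1 (\<lambda>_. V) 1) \<subseteq> face S"
  proof
    fix x assume x: "x \<in> slice S (masses 1 (\<lambda>_. V) 1)"
    have finS: "finite S" using assms finite_subset by blast
    have "(\<Sum>d\<in>S. Poly_Mapping.lookup x d) = (\<Sum>d\<in>V. Poly_Mapping.lookup x d)"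
      by (rule sum.mono_neutral_left) (use assms x in \<open>auto simp: slice_def keys_subset_iff\<close>)
    then have "(\<Sum>d\<in>S. Poly_Mapping.lookup x d) = 1" using x by (simp add: slice_def masses_def)
    then have "(\<Sum>d\<in>S. Poly_Mapping.lookup x d *\<^sub>R unit_vec d) \<in> face S"
      unfolding face_def
      by (intro convex_sum[OF finS convex_convex_hull]) (use x in \<open>auto simp: slice_def intro: hull_inc\<close>)
    then show "x \<in> face S" using sum_unit_vec[OF finS] x by (simp add: slice_def)
  qed
qed

lemma face_sing [simp]: "face {d} = {unit_vec d}"
  by (simp add: face_def)

lemma face_empty [simp]: "face {} = {}"
  by (simp add: face_def)

lemma face_eq_empty_iff [simp]: "face S = {} \<longleftrightarrow> S = {}"
  by (simp add: face_def)

lemma unit_vec_eq_iff [simp]: "unit_vec d = unit_vec e \<longleftrightarrow> d = e"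
  by (metis lookup_unit_vec zero_neq_one)

lemma inj_unit_vec: "inj_on unit_vec S"
  by (simp add: inj_on_def)

lemma keys_face_subset: "finite S \<Longrightarrow> x \<in> face S \<Longrightarrow> Poly_Mapping.keys x \<subseteq> S"
  by (simp add: face_eq_slice[of S S] slice_def)

lemma sum_lookup_face: "finite S \<Longrightarrow> x \<in> face S \<Longrightarrow> (\<Sum>d\<in>S. Poly_Mapping.lookup x d) = 1"
  by (simp add: face_eq_slice[of S S] slice_def masses_def)

lemma face_mono: "S \<subseteq> T \<Longrightarrow> face S \<subseteq> face T"
  unfolding face_def by (intro hull_mono) blast

lemma face_Int:
  assumes "finite S" "finite T"
  shows "face S \<inter> face T = face (S \<inter> T)"
proof -
  have *: "face U = slice U (masses 1 (\<lambda>_. S \<union> T) 1)" if "U \<subseteq> S \<union> T" for U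
    by (rule face_eq_slice) (use assms that in auto)
  show ?thesis using *[of S] *[of T] *[of "S \<inter> T"] slice_Int[of S _ T] by (simp add: inf.coboundedI1)
qed

lemma face_face_of: "finite S \<Longrightarrow> T \<subseteq> S \<Longrightarrow> face T face_of face S"
  by (simp add: face_eq_slice[of S] slice_face_of_slice affine_masses)

lemma face_of_face_iff:
  assumes "finite S"
  shows "F face_of face S \<longleftrightarrow> (\<exists>T\<subseteq>S. F = face T)"
proof
  assume F: "F face_of face S"
  show "\<exists>T\<subseteq>S. F = face T"
  proof (cases "F = {}")
    case True
    then show ?thesis by (intro exI[of _ "{}"]) simp
  next
    case False
    have "F face_of slice S (masses 1 (\<lambda>_. S) 1)" using F face_eq_slice[OF assms, of S] by simp
    then obtain W where "W \<subseteq> S" "F = slice W (masses 1 (\<lambda>_. S) 1)"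
      using face_of_sliceE[OF assms affine_masses _ False] by metis
    then show ?thesis using face_eq_slice[OF assms, of W] by auto
  qed
qed (use assms face_face_of in blast)

lemma unit_vec_affine_independent: "\<not> affine_dependent (unit_vec ` S)"
proof
  assume "affine_dependent (unit_vec ` S)"
  then obtain d where "d \<in> S" "unit_vec d \<in> affine hull (unit_vec ` S - {unit_vec d})"
    by (auto simp: affine_dependent_def)
  moreover have "affine {x :: 'a \<Rightarrow>\<^sub>0 real. Poly_Mapping.lookup x d = 0}"
    by (auto simp: affine_def lookup_add)
  then have "affine hull (unit_vec ` S - {unit_vec d}) \<subseteq> {x. Poly_Mapping.lookup x d = 0}"
    by (intro hull_minimal) (auto simp: lookup_unit_vec)
  ultimately show False by (auto simp: lookup_unit_vec)
qed

lemma is_simplex_face: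
  assumes "finite S"
  shows "is_simplex (int (card S) - 1) (face S)"
  unfolding is_simplex_def face_def using assms
  by (intro exI[of _ "unit_vec ` S"]) (simp add: unit_vec_affine_independent card_image[OF inj_unit_vec])

text \<open>\<open>is_simplex\<close> speaks of some vertex set \<open>C\<close>. Every
  \<open>unit_vec d\<close> with \<open>d\<close> in \<open>S\<close> is an extreme point and so
  belongs to any set having this convex hull, in particular to \<open>C\<close>.\<close>

lemma card_le_if_is_simplex_face:
  assumes S: "finite S" and "is_simplex n (face S)"
  shows "int (card S) \<le> n + 1"
proof -
  obtain C where C: "finite C" "\<not> affine_dependent C" "int (card C) = n + 1" "face S = convex hull C"
    using assms(2) by (auto simp: is_simplex_def)
  have "unit_vec ` S \<subseteq> C"
  proof
    fix x assume "x \<in> unit_vec ` S"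
    then obtain d where "d \<in> S" "x = unit_vec d" by blast
    then have "{x} face_of face S" using face_face_of[OF S, of "{d}"] by simp
    then show "x \<in> C" unfolding C(4) face_of_singleton by (rule extreme_point_of_convex_hull)
  qed
  then have "card (unit_vec ` S) \<le> card C" using C(1) card_mono by blast
  then show ?thesis using C(3) by (simp add: card_image[OF inj_unit_vec])
qed

section \<open>Projected products and joins\<close>

text \<open>The image of \<open>real_prod\<close> under \<open>proj\<close>, by
  \<open>proj_real_prod\<close>. For \<open>g = 0\<close> it is \<open>{0}\<close>, the single
  vertex of the complex for \<open>m = 1\<close>.\<close>

definition cell :: "nat \<Rightarrow> (nat \<Rightarrow> 'a set) \<Rightarrow> ('a \<Rightarrow>\<^sub>0 real) set" where
  "cell g \<sigma> = {(1 / real g) *\<^sub>R (\<Sum>i<g. x i) | x. \<forall>i<g. x i \<in> face (\<sigma> i)}"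

definition point :: "nat \<Rightarrow> 'a set \<Rightarrow> ('a \<Rightarrow>\<^sub>0 real)" where
  "point g X = (1 / real g) *\<^sub>R (\<Sum>d\<in>X. unit_vec d)"

lemma sum_lookup_single:
  fixes x :: "nat \<Rightarrow> 'b::comm_monoid_add"
  shows "(\<Sum>i<g. Poly_Mapping.lookup (\<Sum>j<g. Poly_Mapping.single j (x j)) i) = (\<Sum>i<g. x i)"
proof (rule sum.cong[OF refl])
  fix i assume "i \<in> {..<g}"
  have "Poly_Mapping.lookup (\<Sum>j<g. Poly_Mapping.single j (x j)) i = (\<Sum>j<g. if j = i then x j else 0)"
    unfolding lookup_sum lookup_single when_def ..
  also have "\<dots> = x i"
    using \<open>i \<in> {..<g}\<close> by (simp only: sum.delta[OF finite_lessThan] if_True)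
  finally show "Poly_Mapping.lookup (\<Sum>j<g. Poly_Mapping.single j (x j)) i = x i" .
qed

lemma proj_real_prod: "proj g ` real_prod g \<sigma> = cell g \<sigma>"
proof -
  have p: "proj g ((1 / real g) *\<^sub>R (\<Sum>i<g. Poly_Mapping.single i (x i)), b) = (1 / real g) *\<^sub>R (\<Sum>i<g. x i)"
    for x :: "nat \<Rightarrow> 'a \<Rightarrow>\<^sub>0 real" and b
    by (simp add: proj_def proj_box_def sum_lookup_single flip: scaleR_sum_right)
  show ?thesis
  proof
    show "proj g ` real_prod g \<sigma> \<subseteq> cell g \<sigma>"
    proof
      fix z assume "z \<in> proj g ` real_prod g \<sigma>"
      then obtain x where x: "\<forall>i<g. x i \<in> face (\<sigma> i)"
        and "z = proj g ((1 / real g) *\<^sub>R (\<Sum>i<g. Poly_Mapping.single i (x i)), barycenter g)"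
        unfolding real_prod_def by blast
      then have "z = (1 / real g) *\<^sub>R (\<Sum>i<g. x i)" unfolding p by simp
      then show "z \<in> cell g \<sigma>" using x unfolding cell_def by blast
    qed
    show "cell g \<sigma> \<subseteq> proj g ` real_prod g \<sigma>"
    proof
      fix z assume "z \<in> cell g \<sigma>"
      then obtain x where x: "\<forall>i<g. x i \<in> face (\<sigma> i)" and z: "z = (1 / real g) *\<^sub>R (\<Sum>i<g. x i)"
        unfolding cell_def by blast
      show "z \<in> proj g ` real_prod g \<sigma>"
      proof
        show "z = proj g ((1 / real g) *\<^sub>R (\<Sum>i<g. Poly_Mapping.single i (x i)), barycenter g)"
          unfolding p by (rule z)
        show "((1 / real g) *\<^sub>R (\<Sum>i<g. Poly_Mapping.single i (x i)), barycenter g) \<in> real_prod g \<sigma>"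
          unfolding real_prod_def using x by blast
      qed
    qed
  qed
qed

lemma linear_proj_box: "linear (proj_box g)"
  by (rule linearI)
    (auto simp: proj_box_def split_beta lookup_add sum.distrib scaleR_sum_right)

lemma proj_box_single: "i < g \<Longrightarrow> proj_box g (Poly_Mapping.single i x, b) = (x, b)"
  by (simp add: proj_box_def lookup_single when_def sum.delta)

lemma proj_box_real_join: "proj_box g ` real_join g \<sigma> = convex hull (\<Union>i<g. face (\<sigma> i) \<times> {unit_vec i})"
proof -
  have "proj_box g ` (\<Union>i<g. Poly_Mapping.single i ` face (\<sigma> i) \<times> {unit_vec i})
      = (\<Union>i<g. face (\<sigma> i) \<times> {unit_vec i})"
    unfolding image_UN
  proof (rule SUP_cong[OF refl])
    fix i assume "i \<in> {..<g}"
    then show "proj_box g ` (Poly_Mapping.single i ` face (\<sigma> i) \<times> {unit_vec i}) = face (\<sigma> i) \<times> {unit_vec i}"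
      by (auto simp: proj_box_single image_iff)
  qed
  then show ?thesis
    unfolding real_join_def by (simp add: convex_hull_linear_image[OF linear_proj_box])
qed

text \<open>Linear images commute with convex hulls. Only the union of the blocks survives, which
  turns \<open>D_plus\<close> into a family of faces of one standard simplex.\<close>

lemma proj_real_join: "proj g ` real_join g \<sigma> = face (\<Union>i<g. \<sigma> i)"
proof -
  have "proj g ` real_join g \<sigma> = fst ` (convex hull (\<Union>i<g. face (\<sigma> i) \<times> {unit_vec i}))"
    unfolding proj_def image_comp[symmetric] proj_box_real_join ..
  also have "\<dots> = convex hull (fst ` (\<Union>i<g. face (\<sigma> i) \<times> {unit_vec i}))"
    by (rule convex_hull_linear_image) (simp add: linear_fst)
  also have "fst ` (\<Union>i<g. face (\<sigma> i) \<times> {unit_vec i}) = (\<Union>i<g. face (\<sigma> i))"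
    by (force simp: image_UN)
  also have "convex hull (\<Union>i<g. face (\<sigma> i)) = face (\<Union>i<g. \<sigma> i)"
  proof
    show "convex hull (\<Union>i<g. face (\<sigma> i)) \<subseteq> face (\<Union>i<g. \<sigma> i)"
      by (rule hull_minimal) (auto simp: face_def[of "\<Union>i<g. \<sigma> i"] intro: subsetD[OF face_mono[unfolded face_def]] simp: face_def)
    show "face (\<Union>i<g. \<sigma> i) \<subseteq> convex hull (\<Union>i<g. face (\<sigma> i))"
      unfolding face_def[of "\<Union>i<g. \<sigma> i"]
      by (rule hull_mono) (auto simp: face_def intro: hull_inc)
  qed
  finally show ?thesis .
qed

lemma lookup_barycenter: "i < g \<Longrightarrow> Poly_Mapping.lookup (barycenter g) i = 1 / real g"
  by (simp add: barycenter_def lookup_sum lookup_unit_vec sum.delta)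

text \<open>A point of the lifted join over the barycenter weights all blocks equally, so every block is
  nonempty.\<close>

lemma cayley_slice:
  assumes g: "0 < g" and V: "finite V" "\<And>i. i < g \<Longrightarrow> \<sigma> i \<subseteq> V"
  shows "proj_box g ` real_join g \<sigma> \<inter> (coord_space V \<times> {barycenter g}) =
    (if transversal g \<sigma> then cell g \<sigma> \<times> {barycenter g} else {})"
proof (cases "transversal g \<sigma>")
  case False
  then obtain i where i: "i < g" "\<sigma> i = {}" by (auto simp: transversal_def)
  \<comment> \<open>An empty block \<open>i\<close> leaves no generator with a nonzero
    \<open>i\<close>-th weight, whereas the barycenter has weight \<open>1 / real g\<close>
    there.\<close>
  let ?H = "{z :: ('a \<Rightarrow>\<^sub>0 real) \<times> (nat \<Rightarrow>\<^sub>0 real). Poly_Mapping.lookup (snd z) i = 0}"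
  have "convex ?H" by (rule convexI) (auto simp: lookup_add)
  moreover have "(\<Union>i<g. face (\<sigma> i) \<times> {unit_vec i}) \<subseteq> ?H"
    using i by (auto simp: lookup_unit_vec)
  ultimately have "proj_box g ` real_join g \<sigma> \<subseteq> ?H"
    unfolding proj_box_real_join by (rule hull_minimal[rotated])
  then have H: "Poly_Mapping.lookup (snd z) i = 0" if "z \<in> proj_box g ` real_join g \<sigma>" for z
    using that by blast
  have "snd z \<noteq> barycenter g" if "z \<in> proj_box g ` real_join g \<sigma>" for z
  proof
    assume "snd z = barycenter g"
    then show False using H[OF that] lookup_barycenter[OF i(1)] g by simp
  qed
  then have "proj_box g ` real_join g \<sigma> \<inter> (coord_space V \<times> {barycenter g}) = {}"
    unfolding disjoint_iff mem_Times_iff singleton_iff by (intro allI impI notI) (elim conjE, rule notE)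
  then show ?thesis using False by (simp only: if_False)
next
  case True
  let ?S = "\<lambda>i. face (\<sigma> i) \<times> {unit_vec i}"
  have "\<forall>i\<in>{..<g}. convex (?S i) \<and> ?S i \<noteq> {}"
    using True by (auto simp: transversal_def face_def intro!: convex_Times)
  then have hull: "proj_box g ` real_join g \<sigma> =
      {\<Sum>i<g. c i *\<^sub>R s i | c s. (\<forall>i\<in>{..<g}. 0 \<le> c i) \<and> sum c {..<g} = 1 \<and> (\<forall>i\<in>{..<g}. s i \<in> ?S i)}"
    unfolding proj_box_real_join by (rule convex_hull_finite_union[OF finite_lessThan])
  have "proj_box g ` real_join g \<sigma> \<inter> (coord_space V \<times> {barycenter g}) = cell g \<sigma> \<times> {barycenter g}"
  proof (intro set_eqI iffI)
    fix z assume z: "z \<in> proj_box g ` real_join g \<sigma> \<inter> (coord_space V \<times> {barycenter g})"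
    then obtain c s where s: "\<And>i. i < g \<Longrightarrow> s i \<in> ?S i" and zs: "z = (\<Sum>i<g. c i *\<^sub>R s i)"
      unfolding hull by auto
    have snd: "snd (s i) = unit_vec i" and fst: "fst (s i) \<in> face (\<sigma> i)" if "i < g" for i
      using s[OF that] by auto
    \<comment> \<open>The second components are distinct unit vectors, so the \<open>i\<close>-th
      coordinate of the barycenter reads off the coefficient of block \<open>i\<close>.\<close>
    have c: "c i = 1 / real g" if i: "i < g" for i
    proof -
      have "snd z = barycenter g" using z by (simp only: Int_iff mem_Times_iff singleton_iff)
      then have "1 / real g = Poly_Mapping.lookup (snd z) i" using lookup_barycenter[OF i] by simp
      also have "\<dots> = (\<Sum>j<g. if j = i then c j else 0)"
        unfolding zs snd_sum lookup_sum by (rule sum.cong) (auto simp: snd lookup_unit_vec)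
      finally show ?thesis using i by (simp add: sum.delta)
    qed
    have "fst z = (\<Sum>i<g. (1 / real g) *\<^sub>R fst (s i))"
      unfolding zs fst_sum by (rule sum.cong) (auto simp: c)
    then have "fst z = (1 / real g) *\<^sub>R (\<Sum>i<g. fst (s i))" by (simp add: scaleR_sum_right)
    then have "fst z \<in> cell g \<sigma>" using fst unfolding cell_def by auto
    then show "z \<in> cell g \<sigma> \<times> {barycenter g}" using z by (auto simp: mem_Times_iff)
  next
    fix z assume z: "z \<in> cell g \<sigma> \<times> {barycenter g}"
    then have "fst z \<in> cell g \<sigma>" by auto
    then obtain x where x: "\<And>i. i < g \<Longrightarrow> x i \<in> face (\<sigma> i)" and zx: "fst z = (1 / real g) *\<^sub>R (\<Sum>i<g. x i)"
      unfolding cell_def by blast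
    have "z = (\<Sum>i<g. (1 / real g) *\<^sub>R (x i, unit_vec i))"
      using z zx by (intro prod_eqI) (auto simp: fst_sum snd_sum barycenter_def scaleR_sum_right)
    then have "z \<in> proj_box g ` real_join g \<sigma>"
      unfolding hull using x g by (auto intro!: exI[of _ "\<lambda>_. 1 / real g"] exI[of _ "\<lambda>i. (x i, unit_vec i)"])
    moreover have "fst z \<in> coord_space V"
    proof -
      have "Poly_Mapping.lookup (x i) d = 0" if "i < g" "d \<notin> V" for i d
        using keys_face_subset[of "\<sigma> i" "x i"] x[OF that(1)] V that
        by (meson finite_subset in_keys_iff subsetD)
      then show ?thesis by (simp add: zx coord_space_def keys_subset_iff lookup_sum)
    qed
    ultimately show "z \<in> proj_box g ` real_join g \<sigma> \<inter> (coord_space V \<times> {barycenter g})"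
      using z by (auto simp: mem_Times_iff)
  qed
  then show ?thesis using True by simp
qed

text \<open>Disjoint blocks make the summands recoverable from their mean: \<open>x i\<close> is the
  part of \<open>y\<close> supported on \<open>\<sigma> i\<close>, multiplied by
  \<open>g\<close>.\<close>

lemma cell_eq_slice:
  assumes fin: "\<And>i. i < g \<Longrightarrow> finite (\<sigma> i)"
    and dis: "\<And>i j. i < g \<Longrightarrow> j < g \<Longrightarrow> i \<noteq> j \<Longrightarrow> \<sigma> i \<inter> \<sigma> j = {}"
  shows "cell g \<sigma> = slice (\<Union>i<g. \<sigma> i) (masses g \<sigma> (1 / real g))"
proof (intro set_eqI iffI)
  fix y assume "y \<in> cell g \<sigma>"
  then obtain x where x: "\<And>i. i < g \<Longrightarrow> x i \<in> face (\<sigma> i)" and y: "y = (1 / real g) *\<^sub>R (\<Sum>i<g. x i)"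
    by (auto simp: cell_def)
  have x0: "Poly_Mapping.lookup (x i) d = 0" if "i < g" "d \<notin> \<sigma> i" for i d
    using keys_face_subset[OF fin x] that by (meson in_keys_iff subsetD)
  have xn: "0 \<le> Poly_Mapping.lookup (x i) d" if "i < g" for i d
    using x[OF that] fin[OF that] by (simp add: face_eq_slice[of "\<sigma> i"] slice_def)
  have "(\<Sum>d\<in>\<sigma> j. Poly_Mapping.lookup y d) = 1 / real g" if j: "j < g" for j
  proof -
    have "(\<Sum>d\<in>\<sigma> j. Poly_Mapping.lookup (\<Sum>i<g. x i) d) = (\<Sum>i<g. \<Sum>d\<in>\<sigma> j. Poly_Mapping.lookup (x i) d)"
      unfolding lookup_sum by (rule sum.swap)
    also have "\<dots> = (\<Sum>i<g. if i = j then 1 else 0)"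
    proof (rule sum.cong[OF refl])
      fix i assume "i \<in> {..<g}"
      then show "(\<Sum>d\<in>\<sigma> j. Poly_Mapping.lookup (x i) d) = (if i = j then 1 else 0)"
        using sum_lookup_face[OF fin x] x0 dis[of i j] j by (cases "i = j") (auto intro!: sum.neutral)
    qed
    finally show ?thesis using j by (simp add: y sum.delta flip: sum_divide_distrib)
  qed
  then show "y \<in> slice (\<Union>i<g. \<sigma> i) (masses g \<sigma> (1 / real g))"
    using x0 xn by (auto simp: slice_def masses_def keys_subset_iff y lookup_sum intro!: sum_nonneg divide_nonneg_nonneg)
next
  fix y assume y: "y \<in> slice (\<Union>i<g. \<sigma> i) (masses g \<sigma> (1 / real g))"
  define x where "x i = (\<Sum>d\<in>\<sigma> i. (real g * Poly_Mapping.lookup y d) *\<^sub>R unit_vec d)" for i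
  have "x i \<in> face (\<sigma> i)" if i: "i < g" for i
    unfolding x_def face_def
  proof (rule convex_sum[OF fin[OF i] convex_convex_hull])
    show "(\<Sum>d\<in>\<sigma> i. real g * Poly_Mapping.lookup y d) = 1"
      using y i by (simp add: slice_def masses_def flip: sum_distrib_left)
  qed (use y in \<open>auto simp: slice_def intro: hull_inc\<close>)
  moreover have "(1 / real g) *\<^sub>R (\<Sum>i<g. x i) = y"
  proof (cases "g = 0")
    case True
    then show ?thesis using y by (simp add: slice_def)
  next
    case False
    have "(1 / real g) *\<^sub>R (\<Sum>i<g. x i) = (\<Sum>i<g. \<Sum>d\<in>\<sigma> i. Poly_Mapping.lookup y d *\<^sub>R unit_vec d)"
      using False by (simp add: x_def scaleR_sum_right)
    also have "\<dots> = (\<Sum>d\<in>(\<Union>i<g. \<sigma> i). Poly_Mapping.lookup y d *\<^sub>R unit_vec d)"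
      by (rule sum.UNION_disjoint[symmetric]) (use fin dis in auto)
    also have "\<dots> = y" by (rule sum_unit_vec) (use y fin in \<open>auto simp: slice_def\<close>)
    finally show ?thesis .
  qed
  ultimately show "y \<in> cell g \<sigma>" unfolding cell_def by auto
qed

text \<open>A Minkowski sum of convex hulls is the hull of the Minkowski sum of the generating sets,
  and the latter is finite.\<close>

lemma polytope_cell:
  assumes "\<And>i. i < g \<Longrightarrow> finite (\<sigma> i)"
  shows "polytope (cell g \<sigma>)"
proof -
  have "cell g \<sigma> = (\<lambda>x. (1 / real g) *\<^sub>R x) ` (\<Sum>i<g. face (\<sigma> i))"
    unfolding cell_def set_sum_alt[OF finite_lessThan] by auto
  also have "(\<Sum>i<g. face (\<sigma> i)) = convex hull (\<Sum>i<g. unit_vec ` \<sigma> i)"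
    unfolding face_def by (rule convex_hull_set_sum[symmetric])
  finally have "cell g \<sigma> = convex hull ((\<lambda>x. (1 / real g) *\<^sub>R x) ` (\<Sum>i<g. unit_vec ` \<sigma> i))"
    by (simp add: convex_hull_scaling)
  moreover have "finite (\<Sum>i<n. unit_vec ` \<sigma> i)" if "n \<le> g" for n
    using that by (induction n) (auto intro!: finite_set_plus simp: assms set_zero)
  ultimately show ?thesis by (simp add: polytope_convex_hull)
qed

lemma cell_nonempty_iff: "cell g \<sigma> \<noteq> {} \<longleftrightarrow> transversal g \<sigma>"
proof
  assume "transversal g \<sigma>"
  then have "\<exists>y. i < g \<longrightarrow> y \<in> face (\<sigma> i)" for i
    by (cases "i < g") (simp_all add: transversal_def ex_in_conv)
  then obtain x where "\<And>i. i < g \<Longrightarrow> x i \<in> face (\<sigma> i)" by metis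
  then show "cell g \<sigma> \<noteq> {}" unfolding cell_def by blast
qed (auto simp: cell_def transversal_def)

lemma cell_singletons:
  assumes "inj_on f {..<g}"
  shows "cell g (\<lambda>i. {f i}) = {point g (f ` {..<g})}"
proof -
  have "{(1 / real g) *\<^sub>R (\<Sum>i<g. x i) | x. \<forall>i<g. x i \<in> face {f i}} = {(1 / real g) *\<^sub>R (\<Sum>i<g. unit_vec (f i))}"
  proof (intro set_eqI iffI)
    fix z assume "z \<in> {(1 / real g) *\<^sub>R (\<Sum>i<g. x i) | x. \<forall>i<g. x i \<in> face {f i}}"
    then obtain x where "z = (1 / real g) *\<^sub>R (\<Sum>i<g. x i)" "\<forall>i<g. x i = unit_vec (f i)" by auto
    then show "z \<in> {(1 / real g) *\<^sub>R (\<Sum>i<g. unit_vec (f i))}" by simp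
  next
    fix z assume "z \<in> {(1 / real g) *\<^sub>R (\<Sum>i<g. unit_vec (f i))}"
    moreover have "\<forall>i<g. unit_vec (f i) \<in> face {f i}" by simp
    ultimately show "z \<in> {(1 / real g) *\<^sub>R (\<Sum>i<g. x i) | x. \<forall>i<g. x i \<in> face {f i}}" by blast
  qed
  then show ?thesis unfolding cell_def point_def by (simp add: sum.reindex[OF assms])
qed

lemma lookup_point: "finite X \<Longrightarrow> Poly_Mapping.lookup (point g X) d = (if d \<in> X then 1 / real g else 0)"
  by (simp add: point_def lookup_sum lookup_unit_vec sum.delta)

lemma point_eq_iff:
  assumes "finite X" "finite Y" "card X = g" "card Y = g"
  shows "point g X = point g Y \<longleftrightarrow> X = Y"
proof
  assume eq: "point g X = point g Y"
  show "X = Y"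
  proof (cases "g = 0")
    case False
    have "d \<in> X \<longleftrightarrow> d \<in> Y" for d
      using lookup_point[OF assms(1), of g d] lookup_point[OF assms(2), of g d] eq False
      by (auto split: if_splits)
    then show ?thesis by blast
  qed (use assms in simp)
qed simp

section \<open>Hom complexes of graphs with bounded cliques\<close>

lemma cell_cong: "(\<And>i. i < g \<Longrightarrow> \<sigma> i = \<tau> i) \<Longrightarrow> cell g \<sigma> = cell g \<tau>"
  unfolding cell_def by (intro Collect_cong ex_cong1) auto

definition clique :: "'a graph \<Rightarrow> 'a set \<Rightarrow> bool" where
  "clique H K \<longleftrightarrow> K \<subseteq> verts H \<and> (\<forall>u\<in>K. \<forall>v\<in>K. u \<noteq> v \<longrightarrow> {u, v} \<in> edges H)"

text \<open>The outer \<open>restrict\<close> keeps the tuple extensional, as membership in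
  \<open>hom_plus\<close> demands.\<close>

definition restrict_cell :: "nat \<Rightarrow> (nat \<Rightarrow> 'a set) \<Rightarrow> 'a set \<Rightarrow> nat \<Rightarrow> 'a set" where
  "restrict_cell g \<sigma> W = restrict (\<lambda>i. \<sigma> i \<inter> W) {..<g}"

lemma restrict_cell_apply [simp]: "i < g \<Longrightarrow> restrict_cell g \<sigma> W i = \<sigma> i \<inter> W"
  by (simp add: restrict_cell_def)

lemma restrict_cell_hom_plus: "\<sigma> \<in> hom_plus g H \<Longrightarrow> restrict_cell g \<sigma> W \<in> hom_plus g H"
  unfolding hom_plus_def restrict_cell_def joined_def by (simp add: PiE_iff) blast

lemma restrict_cell_hom_plus_t: "\<sigma> \<in> hom_plus_t g H \<Longrightarrow> restrict_cell g \<sigma> W \<in> hom_plus_t g H"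
  unfolding hom_plus_t_def
proof clarify
  fix \<tau> assume *: "\<sigma> \<in> hom_plus g H" "\<tau> \<in> hom_plus g H" "transversal g \<tau>" "\<forall>i<g. \<sigma> i \<subseteq> \<tau> i"
  then have "\<forall>i<g. restrict_cell g \<sigma> W i \<subseteq> \<tau> i" by auto
  then show "restrict_cell g \<sigma> W \<in> hom_plus g H \<and> (\<exists>\<tau>\<in>hom_plus g H. transversal g \<tau> \<and> (\<forall>i<g. restrict_cell g \<sigma> W i \<subseteq> \<tau> i))"
    using * restrict_cell_hom_plus by blast
qed

lemma hom_eq: "hom g H = {\<sigma> \<in> hom_plus g H. transversal g \<sigma>}"
  by (auto simp: hom_def hom_plus_def transversal_def PiE_iff)

lemma hom_eq_t: "hom g H = {\<sigma> \<in> hom_plus_t g H. transversal g \<sigma>}"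
  unfolding hom_eq hom_plus_t_def by blast

lemma finite_hom_plus: "finite (verts H) \<Longrightarrow> finite (hom_plus g H)"
  unfolding hom_plus_def
  by (rule finite_subset[of _ "{..<g} \<rightarrow>\<^sub>E Pow (verts H)"]) (auto intro!: finite_PiE)

lemma hom_plus_subset: "\<sigma> \<in> hom_plus g H \<Longrightarrow> i < g \<Longrightarrow> \<sigma> i \<subseteq> verts H"
  by (auto simp: hom_plus_def PiE_iff)

lemma hom_plus_edge:
  "\<sigma> \<in> hom_plus g H \<Longrightarrow> i < g \<Longrightarrow> j < g \<Longrightarrow> i \<noteq> j \<Longrightarrow> u \<in> \<sigma> i \<Longrightarrow> v \<in> \<sigma> j \<Longrightarrow> {u, v} \<in> edges H"
  by (auto simp: hom_plus_def joined_def)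

lemma transversal_choice: "transversal g \<sigma> \<Longrightarrow> \<exists>f. \<forall>i<g. f i \<in> \<sigma> i"
  by (intro exI[of _ "\<lambda>i. SOME d. d \<in> \<sigma> i"]) (simp add: transversal_def some_in_eq)

section \<open>Linear sections and simplicial complexes\<close>

text \<open>By \<open>cayley_slice\<close> exactly the transversal cells survive. The transversal
  members of \<open>hom_plus\<close> and of \<open>hom_plus_t\<close> both form \<open>hom\<close>,
  so this covers both linear sections.\<close>

lemma cayley_section_lifted:
  assumes "finite (verts H)" "0 < g" "C \<subseteq> hom_plus g H"
  shows "cayley_section g (verts H) (lifted g C) =
    (\<lambda>P. P \<times> {barycenter g}) ` cell g ` {\<sigma> \<in> C. transversal g \<sigma>}"
proof -
  have "proj_box g ` real_join g \<sigma> \<inter> (coord_space (verts H) \<times> {barycenter g}) =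
      (if transversal g \<sigma> then cell g \<sigma> \<times> {barycenter g} else {})" if "\<sigma> \<in> C" for \<sigma>
    by (rule cayley_slice[OF assms(2,1)]) (use that assms(3) hom_plus_subset in blast)
  then have "cayley_section g (verts H) (lifted g C) =
      (\<lambda>\<sigma>. if transversal g \<sigma> then cell g \<sigma> \<times> {barycenter g} else {}) ` C - {{}}"
    unfolding cayley_section_def lifted_def image_image by (simp cong: image_cong)
  also have "\<dots> = (\<lambda>\<sigma>. cell g \<sigma> \<times> {barycenter g}) ` {\<sigma> \<in> C. transversal g \<sigma>}"
    using cell_nonempty_iff[of g] by (auto simp: image_iff split: if_splits)
  finally show ?thesis by (simp add: image_image)
qed

text \<open>Simplices on subsets of one set of unit vectors meet in common faces. A face is given by
  a subset \<open>W\<close> of the vertices, and intersecting each block with \<open>W\<close>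
  exhibits it as a member of the family.\<close>

lemma simplicial_complex_faces:
  assumes fin: "finite (verts H)" and C: "C \<subseteq> hom_plus g H"
    and down: "\<And>\<sigma> W. \<sigma> \<in> C \<Longrightarrow> restrict_cell g \<sigma> W \<in> C"
  shows "is_simplicial_complex ((\<lambda>\<sigma>. face (\<Union>i<g. \<sigma> i)) ` C)" (is "is_simplicial_complex ?K")
proof -
  have finU: "finite (\<Union>i<g. \<sigma> i)" if "\<sigma> \<in> C" for \<sigma>
    using that C hom_plus_subset[of \<sigma> g H] finite_subset[OF _ fin] by blast
  have *: "face W \<in> ?K" if "\<sigma> \<in> C" "W \<subseteq> (\<Union>i<g. \<sigma> i)" for \<sigma> W
  proof
    show "restrict_cell g \<sigma> W \<in> C" using down that by blast
    have "(\<Union>i<g. restrict_cell g \<sigma> W i) = W" using that(2) by auto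
    then show "face W = face (\<Union>i<g. restrict_cell g \<sigma> W i)" by simp
  qed
  show ?thesis
    unfolding is_simplicial_complex_def
  proof (intro conjI ballI allI impI)
    show "finite ?K" using finite_subset[OF C finite_hom_plus[OF fin]] by simp
    show "\<exists>n. is_simplex n S" if "S \<in> ?K" for S
      using that is_simplex_face[OF finU] by blast
    show "F \<in> ?K" if SF: "S \<in> ?K \<and> F face_of S" for F S
    proof -
      obtain \<sigma> where \<sigma>: "\<sigma> \<in> C" "S = face (\<Union>i<g. \<sigma> i)" using SF by blast
      then obtain T where "T \<subseteq> (\<Union>i<g. \<sigma> i)" "F = face T"
        using SF face_of_face_iff[OF finU[OF \<sigma>(1)]] by auto
      then show ?thesis using *[OF \<sigma>(1)] by simp
    qed
    show "(S \<inter> S') face_of S" if SS: "S \<in> ?K \<and> S' \<in> ?K" for S S'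
    proof -
      obtain \<sigma> \<tau> where \<sigma>: "\<sigma> \<in> C" "S = face (\<Union>i<g. \<sigma> i)" and \<tau>: "\<tau> \<in> C" "S' = face (\<Union>i<g. \<tau> i)"
        using SS by blast
      show ?thesis unfolding \<sigma>(2) \<tau>(2) face_Int[OF finU[OF \<sigma>(1)] finU[OF \<tau>(1)]]
        by (rule face_face_of[OF finU[OF \<sigma>(1)]]) blast
    qed
  qed
qed

text \<open>The same \<open>g\<close> bounds the cliques and counts the blocks of a cell;
  \<open>same_block_not_edge\<close> rests on this coincidence.\<close>

locale clique_bounded_graph =
  fixes H :: "'a graph" and g :: nat
  assumes finite_verts: "finite (verts H)"
    and loopless: "{u} \<notin> edges H"
    and card_clique_le: "clique H K \<Longrightarrow> card K \<le> g"
begin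

lemma finite_hom: "\<sigma> \<in> hom_plus g H \<Longrightarrow> i < g \<Longrightarrow> finite (\<sigma> i)"
  by (rule finite_subset[OF hom_plus_subset finite_verts])

text \<open>A common vertex \<open>u\<close> would have to be joined to itself by the edge
  \<open>{u, u}\<close>, which is the excluded loop \<open>{u}\<close>.\<close>

lemma hom_plus_disjoint:
  assumes "\<sigma> \<in> hom_plus g H" "i < g" "j < g" "i \<noteq> j"
  shows "\<sigma> i \<inter> \<sigma> j = {}"
  using hom_plus_edge[OF assms] loopless by fastforce

lemma cell_slice:
  "\<sigma> \<in> hom_plus g H \<Longrightarrow> cell g \<sigma> = slice (\<Union>i<g. \<sigma> i) (masses g \<sigma> (1 / real g))"
  by (rule cell_eq_slice) (use finite_hom hom_plus_disjoint in blast)+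

text \<open>Shrinking the blocks alters the sums in \<open>masses\<close>, but for points supported
  in \<open>W\<close> the sums over old and new blocks agree.\<close>

lemma cell_restrict:
  assumes \<sigma>: "\<sigma> \<in> hom_plus g H" and W: "W \<subseteq> (\<Union>i<g. \<sigma> i)"
  shows "cell g (restrict_cell g \<sigma> W) = slice W (masses g \<sigma> (1 / real g))"
proof -
  let ?\<tau> = "restrict_cell g \<sigma> W"
  have "(\<Union>i<g. ?\<tau> i) = W" using W by auto
  then have "cell g ?\<tau> = slice W (masses g ?\<tau> (1 / real g))"
    using cell_slice[OF restrict_cell_hom_plus[OF \<sigma>]] by simp
  moreover have "(\<Sum>d\<in>?\<tau> i. Poly_Mapping.lookup x d) = (\<Sum>d\<in>\<sigma> i. Poly_Mapping.lookup x d)"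
    if "Poly_Mapping.keys x \<subseteq> W" "i < g" for x :: "'a \<Rightarrow>\<^sub>0 real" and i
    using that finite_hom[OF \<sigma>] by (intro sum.mono_neutral_left) (auto simp: keys_subset_iff)
  ultimately show ?thesis by (auto simp: slice_def masses_def)
qed

text \<open>Since the blocks of \<open>\<sigma>\<close> are disjoint, \<open>\<tau>\<close> is the
  restriction of \<open>\<sigma>\<close> to the union of its own blocks, and restriction corresponds
  to deleting coordinates of the slice.\<close>

lemma subcell_face_of:
  assumes "\<sigma> \<in> hom_plus g H" and \<tau>: "\<And>i. i < g \<Longrightarrow> \<tau> i \<subseteq> \<sigma> i"
  shows "cell g \<tau> face_of cell g \<sigma>"
proof -
  let ?W = "\<Union>i<g. \<tau> i"
  have "restrict_cell g \<sigma> ?W i = \<tau> i" if "i < g" for i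
  proof -
    have "\<tau> j \<inter> \<sigma> i \<subseteq> \<tau> i" if "j < g" for j
      using \<tau>[OF that] hom_plus_disjoint[OF assms(1) that \<open>i < g\<close>] by (cases "j = i") auto
    then show ?thesis using \<tau>[OF that] that by auto
  qed
  then have "cell g \<tau> = cell g (restrict_cell g \<sigma> ?W)" by (intro cell_cong) simp
  also have "\<dots> = slice ?W (masses g \<sigma> (1 / real g))"
    by (rule cell_restrict[OF assms(1)]) (use \<tau> in blast)
  also have "\<dots> face_of cell g \<sigma>"
    unfolding cell_slice[OF assms(1)] by (rule slice_face_of_slice[OF affine_masses]) (use \<tau> in blast)
  finally show ?thesis .
qed

text \<open>Otherwise the sum over the block would be zero, whereas \<open>i < g\<close> makes
  \<open>1 / real g\<close> nonzero.\<close>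

lemma keys_meet_block:
  assumes "x \<in> masses g \<sigma> (1 / real g)" "i < g"
  shows "Poly_Mapping.keys x \<inter> \<sigma> i \<noteq> {}"
proof
  assume "Poly_Mapping.keys x \<inter> \<sigma> i = {}"
  then have "(\<Sum>d\<in>\<sigma> i. Poly_Mapping.lookup x d) = 0" by (intro sum.neutral) (auto simp: in_keys_iff)
  then show False using assms by (simp add: masses_def)
qed

text \<open>Two adjacent vertices in one block, together with one vertex from each other block, would form a
  clique with \<open>g + 1\<close> elements. Hence the blocks are the classes of non-adjacency.\<close>

lemma same_block_not_edge:
  assumes \<sigma>: "\<sigma> \<in> hom g H" and i: "i < g" and uv: "u \<in> \<sigma> i" "v \<in> \<sigma> i" "u \<noteq> v"
  shows "{u, v} \<notin> edges H"
proof
  assume e: "{u, v} \<in> edges H"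
  have \<sigma>p: "\<sigma> \<in> hom_plus g H" and t: "transversal g \<sigma>" using \<sigma> by (auto simp: hom_eq)
  obtain f where f: "\<And>j. j < g \<Longrightarrow> f j \<in> \<sigma> j" using transversal_choice[OF t] by blast
  let ?K = "insert u (insert v (f ` ({..<g} - {i})))"
  have inj: "inj_on f ({..<g} - {i})"
    using f hom_plus_disjoint[OF \<sigma>p] by (intro inj_onI) (metis DiffD1 IntI empty_iff lessThan_iff)
  have nm: "u \<notin> f ` ({..<g} - {i})" "v \<notin> f ` ({..<g} - {i})"
    using f uv hom_plus_disjoint[OF \<sigma>p _ i] by fastforce+
  then have "card ?K = g - 1 + 2" using uv(3) inj i by (simp add: card_image)
  moreover have "clique H ?K"
  proof -
    have 1: "{f j, f l} \<in> edges H" if "j < g" "l < g" "j \<noteq> l" for j l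
      using hom_plus_edge[OF \<sigma>p that] f that by blast
    have 2: "{w, f j} \<in> edges H" "{f j, w} \<in> edges H" if "j < g" "j \<noteq> i" "w \<in> {u, v}" for j w
      using hom_plus_edge[OF \<sigma>p i that(1)] hom_plus_edge[OF \<sigma>p that(1) i] that uv f by auto
    have "?K \<subseteq> verts H" using hom_plus_subset[OF \<sigma>p] f uv i by blast
    moreover have "{x, y} \<in> edges H" if "x \<in> ?K" "y \<in> ?K" "x \<noteq> y" for x y
      using that 1 2 e by (auto simp: insert_commute) blast+
    ultimately show ?thesis by (auto simp: clique_def)
  qed
  ultimately show False using card_clique_le[of ?K] i by simp
qed

text \<open>For distinct elements of \<open>W\<close>, sharing a block means being non-adjacent, in
  either cell. Hence a block of \<open>\<tau>\<close> that meets \<open>W\<close> has the same trace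
  on \<open>W\<close> as a block of \<open>\<sigma>\<close>, and for points supported in
  \<open>W\<close> its equation is one of those of \<open>\<sigma>\<close>.\<close>

lemma masses_agree:
  assumes \<sigma>: "\<sigma> \<in> hom g H" and \<tau>: "\<tau> \<in> hom g H" and W: "W \<subseteq> (\<Union>i<g. \<sigma> i)" "W \<subseteq> (\<Union>i<g. \<tau> i)"
    and meet: "\<And>i. i < g \<Longrightarrow> W \<inter> \<tau> i \<noteq> {}"
  shows "slice W (masses g \<sigma> c) \<subseteq> masses g \<tau> c"
proof
  fix x assume x: "x \<in> slice W (masses g \<sigma> c)"
  have p: "\<sigma> \<in> hom_plus g H" "\<tau> \<in> hom_plus g H" using \<sigma> \<tau> by (auto simp: hom_eq)
  have restr: "(\<Sum>d\<in>\<rho> i \<inter> W. Poly_Mapping.lookup x d) = (\<Sum>d\<in>\<rho> i. Poly_Mapping.lookup x d)"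
    if "\<rho> \<in> hom_plus g H" "i < g" for \<rho> i
    using x finite_hom[OF that] by (intro sum.mono_neutral_left) (auto simp: slice_def keys_subset_iff)
  have "(\<Sum>d\<in>\<tau> j. Poly_Mapping.lookup x d) = c" if j: "j < g" for j
  proof -
    obtain u where u: "u \<in> W" "u \<in> \<tau> j" using meet[OF j] by blast
    then obtain i where i: "i < g" "u \<in> \<sigma> i" using W by blast
    have "v \<in> \<tau> j \<longleftrightarrow> v \<in> \<sigma> i" if v: "v \<in> W" for v
    proof -
      obtain i' j' where *: "i' < g" "v \<in> \<sigma> i'" "j' < g" "v \<in> \<tau> j'" using v W by blast
      have "v \<in> \<sigma> i \<longleftrightarrow> v = u \<or> {u, v} \<notin> edges H"
        using same_block_not_edge[OF \<sigma> i(1,2)] hom_plus_edge[OF p(1) i(1) *(1)] i * by blast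
      moreover have "v \<in> \<tau> j \<longleftrightarrow> v = u \<or> {u, v} \<notin> edges H"
        using same_block_not_edge[OF \<tau> j u(2)] hom_plus_edge[OF p(2) j *(3)] u * by blast
      ultimately show ?thesis by blast
    qed
    then have "\<tau> j \<inter> W = \<sigma> i \<inter> W" by blast
    then have "(\<Sum>d\<in>\<tau> j. Poly_Mapping.lookup x d) = (\<Sum>d\<in>\<sigma> i. Poly_Mapping.lookup x d)"
      using restr[OF p(1) i(1)] restr[OF p(2) j] by simp
    then show ?thesis using x i(1) by (auto simp: slice_def masses_def)
  qed
  then show "x \<in> masses g \<tau> c" by (simp add: masses_def)
qed

text \<open>The support of a common point lies in both unions of blocks and meets every block of
  \<open>\<tau>\<close>. On the common vertices the equations of \<open>\<sigma>\<close> thus imply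
  those of \<open>\<tau>\<close>, and the intersection is a slice of the first cell by fewer
  coordinates.\<close>

lemma cell_Int_face_of:
  assumes \<sigma>: "\<sigma> \<in> hom g H" and \<tau>: "\<tau> \<in> hom g H"
  shows "(cell g \<sigma> \<inter> cell g \<tau>) face_of cell g \<sigma>"
proof (cases "cell g \<sigma> \<inter> cell g \<tau> = {}")
  case False
  then obtain x where x: "x \<in> cell g \<sigma>" "x \<in> cell g \<tau>" by blast
  have p: "\<sigma> \<in> hom_plus g H" "\<tau> \<in> hom_plus g H" using \<sigma> \<tau> by (auto simp: hom_eq)
  note s = cell_slice[OF p(1)] cell_slice[OF p(2)]
  let ?W = "(\<Union>i<g. \<sigma> i) \<inter> (\<Union>i<g. \<tau> i)"
  have "?W \<inter> \<tau> i \<noteq> {}" if "i < g" for i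
    using keys_meet_block[of x \<tau> i] that x unfolding s by (auto simp: slice_def)
  then have "slice ?W (masses g \<sigma> (1 / real g)) \<subseteq> masses g \<tau> (1 / real g)"
    by (intro masses_agree[OF \<sigma> \<tau>]) auto
  then have "cell g \<sigma> \<inter> cell g \<tau> = slice ?W (masses g \<sigma> (1 / real g))"
    unfolding s by (auto simp: slice_def)
  then show ?thesis
    unfolding s(1) using slice_face_of_slice[OF affine_masses, of ?W "\<Union>i<g. \<sigma> i"] by auto
qed simp

lemma polytopal_complex_cells: "is_polytopal_complex (cell g ` hom g H)"
  unfolding is_polytopal_complex_def
proof (intro conjI ballI allI impI)
  show "finite (cell g ` hom g H)" using finite_hom_plus[OF finite_verts] by (simp add: hom_eq)
  show "polytope P" if "P \<in> cell g ` hom g H" for P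
    using that finite_hom by (auto simp: hom_eq intro!: polytope_cell)
  show "P \<noteq> {}" if "P \<in> cell g ` hom g H" for P
    using that cell_nonempty_iff by (auto simp: hom_eq)
  show "(P \<inter> P') face_of P" if "P \<in> cell g ` hom g H \<and> P' \<in> cell g ` hom g H" for P P'
    using that cell_Int_face_of by blast
  fix F P assume "P \<in> cell g ` hom g H \<and> F face_of P \<and> F \<noteq> {}"
  then obtain \<sigma> where \<sigma>: "\<sigma> \<in> hom_plus g H" and F: "F face_of cell g \<sigma>" "F \<noteq> {}"
    by (auto simp: hom_eq)
  have "finite (\<Union>i<g. \<sigma> i)" using finite_hom[OF \<sigma>] by blast
  then obtain W where W: "W \<subseteq> (\<Union>i<g. \<sigma> i)" "F = slice W (masses g \<sigma> (1 / real g))"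
    using face_of_sliceE[OF _ affine_masses F(1)[unfolded cell_slice[OF \<sigma>]] F(2)] by blast
  then have "F = cell g (restrict_cell g \<sigma> W)" using cell_restrict[OF \<sigma>] by simp
  \<comment> \<open>As the face is nonempty, no restricted block is empty, so the tuple belongs to
    \<open>hom\<close> and not merely to \<open>hom_plus\<close>.\<close>
  moreover have "restrict_cell g \<sigma> W \<in> hom g H"
    using F(2) cell_nonempty_iff restrict_cell_hom_plus[OF \<sigma>] unfolding calculation hom_eq by blast
  ultimately show "F \<in> cell g ` hom g H" by blast
qed

section \<open>Vertices and edges of the complex of cells\<close>

text \<open>Disjointness of the blocks separates the chosen vertices and the joining condition
  supplies the edges. This links the vertices of a cell to cliques with \<open>g\<close>
  elements.\<close>

lemma choice_clique:
  assumes \<sigma>: "\<sigma> \<in> hom_plus g H" and f: "\<And>i. i < g \<Longrightarrow> f i \<in> \<sigma> i"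
  shows "inj_on f {..<g}" "clique H (f ` {..<g})"
proof -
  show "inj_on f {..<g}"
  proof (rule inj_onI, rule ccontr)
    fix i j assume "i \<in> {..<g}" "j \<in> {..<g}" "f i = f j" "i \<noteq> j"
    then show False using f[of i] f[of j] hom_plus_disjoint[OF \<sigma>, of i j] by auto
  qed
  have "f ` {..<g} \<subseteq> verts H" using f hom_plus_subset[OF \<sigma>] by blast
  moreover have "{f i, f j} \<in> edges H" if "i < g" "j < g" "f i \<noteq> f j" for i j
    using hom_plus_edge[OF \<sigma> that(1,2)] that f by blast
  ultimately show "clique H (f ` {..<g})" by (auto simp: clique_def)
qed

lemma clique_enum:
  assumes "clique H X" "card X = g"
  obtains f where "inj_on f {..<g}" "X = f ` {..<g}"
proof -
  have "finite X" using assms(1) finite_subset[OF _ finite_verts] by (auto simp: clique_def)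
  then obtain f where "bij_betw f {0..<g} X" using ex_bij_betw_nat_finite assms(2) by blast
  then show thesis using that by (auto simp: bij_betw_def lessThan_atLeast0)
qed

lemma singletons_hom:
  assumes "inj_on f {..<g}" "clique H (f ` {..<g})"
  shows "restrict (\<lambda>i. {f i}) {..<g} \<in> hom g H"
proof -
  have "{f i, f j} \<in> edges H" if "i < g" "j < g" "i \<noteq> j" for i j
    using assms that inj_onD[OF assms(1), of i j] unfolding clique_def by auto
  then show ?thesis using assms(2) by (auto simp: hom_def joined_def clique_def)
qed

lemma cell_restrict_singletons:
  "inj_on f {..<g} \<Longrightarrow> cell g (restrict (\<lambda>i. {f i}) {..<g}) = {point g (f ` {..<g})}"
  using cell_singletons[of f g] cell_cong[of g "restrict (\<lambda>i. {f i}) {..<g}" "\<lambda>i. {f i}"] by simp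

lemma point_extreme:
  assumes \<sigma>: "\<sigma> \<in> hom_plus g H" and f: "\<And>i. i < g \<Longrightarrow> f i \<in> \<sigma> i"
  shows "point g (f ` {..<g}) extreme_point_of cell g \<sigma>"
proof -
  have "cell g (\<lambda>i. {f i}) face_of cell g \<sigma>" by (rule subcell_face_of[OF \<sigma>]) (use f in blast)
  moreover have "cell g (\<lambda>i. {f i}) = {point g (f ` {..<g})}"
    using cell_singletons choice_clique(1)[OF \<sigma> f] by blast
  ultimately show ?thesis by (simp add: face_of_singleton)
qed

lemma vertices_cells:
  "{x. {x} \<in> cell g ` hom g H} = point g ` {X. clique H X \<and> card X = g}"
proof (intro set_eqI iffI)
  fix x assume "x \<in> {x. {x} \<in> cell g ` hom g H}"
  then obtain \<sigma> where \<sigma>: "\<sigma> \<in> hom_plus g H" "transversal g \<sigma>" and x: "{x} = cell g \<sigma>"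
    by (auto simp: hom_eq)
  obtain f where f: "\<And>i. i < g \<Longrightarrow> f i \<in> \<sigma> i" using transversal_choice[OF \<sigma>(2)] by blast
  have "point g (f ` {..<g}) \<in> cell g \<sigma>"
    using point_extreme[OF \<sigma>(1) f] by (simp add: extreme_point_of_def)
  then have "x = point g (f ` {..<g})" using x by (metis singletonD)
  moreover have "card (f ` {..<g}) = g" using choice_clique(1)[OF \<sigma>(1) f] by (simp add: card_image)
  ultimately show "x \<in> point g ` {X. clique H X \<and> card X = g}"
    using choice_clique(2)[OF \<sigma>(1) f] by blast
next
  fix x assume "x \<in> point g ` {X. clique H X \<and> card X = g}"
  then obtain X where X: "clique H X" "card X = g" "x = point g X" by blast
  obtain f where f: "inj_on f {..<g}" "X = f ` {..<g}" by (rule clique_enum[OF X(1,2)])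
  have "{x} = cell g (restrict (\<lambda>i. {f i}) {..<g})" unfolding X(3) f(2) by (rule cell_restrict_singletons[OF f(1), symmetric])
  then show "x \<in> {x. {x} \<in> cell g ` hom g H}" using singletons_hom f X(1) by blast
qed

text \<open>Replacing one element \<open>a\<close> of a clique by \<open>b\<close> sweeps out the cell with the block \<open>{a, b}\<close>.\<close>

lemma exchange_cell:
  assumes X: "clique H X" "card X = g" and Y: "clique H Y" "card Y = g"
    and c: "card (X - Y) = 1" "card (Y - X) = 1"
  shows "closed_segment (point g X) (point g Y) \<in> cell g ` hom g H"
proof -
  obtain a b where a: "X - Y = {a}" and b: "Y - X = {b}" using c by (auto simp: card_1_singleton_iff)
  have ab: "a \<in> X" "a \<notin> Y" "b \<in> Y" "b \<notin> X" "a \<noteq> b" using a b by blast+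
  have Yeq: "Y = insert b (X - {a})" using a b by blast
  obtain f where f: "inj_on f {..<g}" "X = f ` {..<g}" by (rule clique_enum[OF X])
  obtain i where i: "i < g" "f i = a" using ab(1) f(2) by auto
  define \<sigma> where "\<sigma> = restrict (\<lambda>j. if j = i then {a, b} else {f j}) {..<g}"
  have \<sigma>i: "\<sigma> i = {a, b}" and \<sigma>j: "\<And>j. j < g \<Longrightarrow> j \<noteq> i \<Longrightarrow> \<sigma> j = {f j}"
    using i by (auto simp: \<sigma>_def)
  have fj: "f j \<in> X \<inter> Y" "f j \<noteq> a" "f j \<noteq> b" if "j < g" "j \<noteq> i" for j
  proof -
    show 1: "f j \<noteq> a" using inj_onD[OF f(1), of j i] i that by auto
    have "f j \<in> X" using f(2) that by blast
    then show "f j \<in> X \<inter> Y" "f j \<noteq> b" using 1 Yeq ab(4) by auto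
  qed
  have eX: "{u, v} \<in> edges H" if "u \<in> X" "v \<in> X" "u \<noteq> v" for u v using that X(1) by (auto simp: clique_def)
  have eY: "{u, v} \<in> edges H" if "u \<in> Y" "v \<in> Y" "u \<noteq> v" for u v using that Y(1) by (auto simp: clique_def)
  \<comment> \<open>The two exchanged vertices share a block, so no edge between them is asked for;
    any other pair lies within \<open>X\<close> or within \<open>Y\<close>.\<close>
  have "joined g H \<sigma>"
    unfolding joined_def
  proof (intro allI impI ballI)
    fix j l u v assume jl: "j < g" "l < g" "j \<noteq> l" and uv: "u \<in> \<sigma> j" "v \<in> \<sigma> l"
    consider "j = i" | "l = i" | "j \<noteq> i" "l \<noteq> i" by blast
    then show "{u, v} \<in> edges H"
    proof cases
      case 1
      then have v: "v = f l" "u = a \<or> u = b" using jl uv \<sigma>i \<sigma>j[of l] by auto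
      then show ?thesis using fj[of l] jl 1 eX[of u v] eY[of u v] ab by blast
    next
      case 2
      then have u: "u = f j" "v = a \<or> v = b" using jl uv \<sigma>i \<sigma>j[of j] by auto
      then show ?thesis using fj[of j] jl 2 eX[of u v] eY[of u v] ab by blast
    next
      case 3
      then have "u = f j" "v = f l" using jl uv \<sigma>j by auto
      then show ?thesis using fj[of l] fj[of j] jl 3 eX[of u v] inj_onD[OF f(1), of j l] by auto
    qed
  qed
  moreover have "\<sigma> j \<subseteq> verts H \<and> \<sigma> j \<noteq> {}" if "j < g" for j
    using X(1) Y(1) ab fj[OF that] \<sigma>i \<sigma>j[OF that] by (cases "j = i") (auto simp: clique_def)
  ultimately have \<sigma>: "\<sigma> \<in> hom g H" by (auto simp: hom_def \<sigma>_def PiE_iff)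
  define r where "r = (\<Sum>d\<in>X - {a}. unit_vec d :: 'a \<Rightarrow>\<^sub>0 real)"
  have finX: "finite X" using f by simp
  have pX: "point g X = (1 / real g) *\<^sub>R (unit_vec a + r)"
    using ab(1) finX by (simp add: point_def r_def sum.remove)
  have pY: "point g Y = (1 / real g) *\<^sub>R (unit_vec b + r)"
    unfolding point_def r_def Yeq using ab(4) finX by (subst sum.insert) auto
  have fi: "f ` ({..<g} - {i}) = X - {a}" using f i by (auto simp: inj_on_def)
  have r: "(\<Sum>j\<in>{..<g} - {i}. unit_vec (f j)) = r"
    unfolding r_def fi[symmetric] by (rule sum.reindex[symmetric, unfolded o_def]) (rule inj_on_subset[OF f(1)], blast)
  have fab: "face {a, b} = closed_segment (unit_vec a) (unit_vec b)"
    by (simp add: face_def segment_convex_hull)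
  have sum: "(\<Sum>j<g. x j) = x i + r" if "\<forall>j<g. x j \<in> face (\<sigma> j)" for x
  proof -
    have "(\<Sum>j<g. x j) = x i + (\<Sum>j\<in>{..<g} - {i}. x j)" using i by (simp add: sum.remove)
    also have "(\<Sum>j\<in>{..<g} - {i}. x j) = (\<Sum>j\<in>{..<g} - {i}. unit_vec (f j))"
      using that \<sigma>j by (intro sum.cong) auto
    finally show ?thesis using r by simp
  qed
  have seg: "(1 / real g) *\<^sub>R ((1 - t) *\<^sub>R unit_vec a + t *\<^sub>R unit_vec b + r)
      = (1 - t) *\<^sub>R point g X + t *\<^sub>R point g Y" for t
  proof -
    have "(1 - t) *\<^sub>R unit_vec a + t *\<^sub>R unit_vec b + r = (1 - t) *\<^sub>R (unit_vec a + r) + t *\<^sub>R (unit_vec b + r)"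
      by (simp add: algebra_simps)
    then show ?thesis unfolding pX pY by (simp only: scaleR_right_distrib scaleR_left_commute)
  qed
  have "cell g \<sigma> = closed_segment (point g X) (point g Y)"
  proof (intro set_eqI iffI)
    fix z assume "z \<in> cell g \<sigma>"
    then obtain x where x: "\<forall>j<g. x j \<in> face (\<sigma> j)" and z: "z = (1 / real g) *\<^sub>R (\<Sum>j<g. x j)"
      unfolding cell_def by blast
    have "x i \<in> closed_segment (unit_vec a) (unit_vec b)" using x i \<sigma>i fab by auto
    then obtain t where "0 \<le> t" "t \<le> 1" "x i = (1 - t) *\<^sub>R unit_vec a + t *\<^sub>R unit_vec b"
      by (auto simp: in_segment)
    then show "z \<in> closed_segment (point g X) (point g Y)"
      using z sum[OF x] seg[of t] by (auto simp: in_segment)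
  next
    fix z assume "z \<in> closed_segment (point g X) (point g Y)"
    then obtain t where t: "0 \<le> t" "t \<le> 1" "z = (1 - t) *\<^sub>R point g X + t *\<^sub>R point g Y"
      by (auto simp: in_segment)
    define x where "x j = (if j = i then (1 - t) *\<^sub>R unit_vec a + t *\<^sub>R unit_vec b else unit_vec (f j))" for j
    have "x i \<in> face (\<sigma> i)" unfolding \<sigma>i fab using t by (auto simp: x_def in_segment)
    then have x: "\<forall>j<g. x j \<in> face (\<sigma> j)" using \<sigma>j by (auto simp: x_def)
    have "z = (1 / real g) *\<^sub>R (\<Sum>j<g. x j)"
      unfolding sum[OF x] t(3) seg[symmetric] by (simp add: x_def)
    then show "z \<in> cell g \<sigma>" using x unfolding cell_def by blast
  qed
  then show ?thesis using \<sigma> by blast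
qed

text \<open>If all blocks were singletons, the cell would be a point. Two choices that differ in one
  larger block give two distinct extreme points of the cell, and a segment has only its ends to
  offer. The corresponding cliques differ by exactly that exchange.\<close>

lemma segment_cell_exchange:
  assumes \<sigma>: "\<sigma> \<in> hom g H" and seg: "cell g \<sigma> = closed_segment x y" and "x \<noteq> y"
  obtains X Y where "clique H X" "card X = g" "clique H Y" "card Y = g"
    "card (X - Y) = 1" "card (Y - X) = 1" "{x, y} = {point g X, point g Y}"
proof -
  have p: "\<sigma> \<in> hom_plus g H" "transversal g \<sigma>" using \<sigma> by (auto simp: hom_eq)
  obtain f where f: "\<And>i. i < g \<Longrightarrow> f i \<in> \<sigma> i" using transversal_choice[OF p(2)] by blast
  have "\<exists>i<g. \<sigma> i \<noteq> {f i}"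
  proof (rule ccontr)
    assume "\<not> ?thesis"
    then have "cell g \<sigma> = cell g (\<lambda>i. {f i})" by (intro cell_cong) auto
    then have "closed_segment x y = {point g (f ` {..<g})}"
      using seg cell_singletons[OF choice_clique(1)[OF p(1) f]] by simp
    then have "x = point g (f ` {..<g})" "y = point g (f ` {..<g})"
      using ends_in_segment(1)[of x y] ends_in_segment(2)[of y x] by (simp_all only: singleton_iff)
    then show False using \<open>x \<noteq> y\<close> by simp
  qed
  then obtain i b where i: "i < g" "b \<in> \<sigma> i" "b \<noteq> f i" using f by blast
  define f' where "f' = f(i := b)"
  have f': "f' j \<in> \<sigma> j" if "j < g" for j using that f i by (simp add: f'_def)
  let ?X = "f ` {..<g}" and ?Y = "f' ` {..<g}"
  note K = choice_clique[OF p(1) f] choice_clique[OF p(1) f']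
  have card: "card ?X = g" "card ?Y = g" using K by (simp_all add: card_image)
  have nm: "b \<noteq> f j" "f i \<noteq> f' j" if "j < g" for j
  proof -
    show "b \<noteq> f j" using i f[OF that] hom_plus_disjoint[OF p(1) i(1) that] by (cases "j = i") auto
    show "f i \<noteq> f' j"
      using i f[OF i(1)] f[OF that] hom_plus_disjoint[OF p(1) i(1) that] by (cases "j = i") (auto simp: f'_def)
  qed
  have "?X - ?Y = {f i}"
  proof
    show "?X - ?Y \<subseteq> {f i}" by (auto simp: f'_def image_iff)
    show "{f i} \<subseteq> ?X - ?Y" using i nm by auto
  qed
  moreover have "?Y - ?X = {b}"
  proof
    show "?Y - ?X \<subseteq> {b}" by (auto simp: f'_def image_iff)
    have "f' i = b" by (simp add: f'_def)
    then show "{b} \<subseteq> ?Y - ?X" using i nm by auto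
  qed
  moreover have "{x, y} = {point g ?X, point g ?Y}"
  proof -
    have *: "z = x \<or> z = y" if "z extreme_point_of cell g \<sigma>" for z
      using extreme_point_of_convex_hull[of z "{x, y}"] that unfolding seg segment_convex_hull by auto
    then have "point g ?X \<in> {x, y}" "point g ?Y \<in> {x, y}"
      using *[OF point_extreme[OF p(1) f]] *[OF point_extreme[OF p(1) f']]
      by (simp_all only: insert_iff empty_iff simp_thms)
    moreover have "?X \<noteq> ?Y"
    proof
      assume "?X = ?Y"
      then have "{f i} = {}" using \<open>?X - ?Y = {f i}\<close> by (simp only: Diff_cancel)
      then show False by simp
    qed
    then have "point g ?X \<noteq> point g ?Y" using point_eq_iff[of ?X ?Y g] card by simp
    ultimately show ?thesis by (metis doubleton_eq_iff insertE singletonD)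
  qed
  ultimately show thesis using that[of ?X ?Y] K card by simp
qed

lemma graph_iso_one_skeleton:
  "graph_iso (point g)
     ({X. clique H X \<and> card X = g},
      {{X, Y} | X Y. X \<in> {X. clique H X \<and> card X = g} \<and> Y \<in> {X. clique H X \<and> card X = g} \<and>
        card (X - Y) = 1 \<and> card (Y - X) = 1})
     (one_skeleton (cell g ` hom g H))"
  unfolding graph_iso_def one_skeleton_def fst_conv snd_conv
proof
  let ?K = "{X. clique H X \<and> card X = g}"
  have fin: "finite X" if "X \<in> ?K" for X
    using that finite_subset[OF _ finite_verts] by (auto simp: clique_def)
  have inj: "X = Y" if "X \<in> ?K" "Y \<in> ?K" "point g X = point g Y" for X Y
    using that point_eq_iff[OF fin[OF that(1)] fin[OF that(2)]] by simp
  then show "bij_betw (point g) ?K {x. {x} \<in> cell g ` hom g H}"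
    unfolding vertices_cells by (auto simp: bij_betw_def inj_on_def)
  show "{{x, y} | x y. x \<noteq> y \<and> closed_segment x y \<in> cell g ` hom g H} =
    (\<lambda>e. point g ` e) ` {{X, Y} | X Y. X \<in> ?K \<and> Y \<in> ?K \<and> card (X - Y) = 1 \<and> card (Y - X) = 1}"
    (is "?L = ?R")
  proof (intro set_eqI iffI)
    fix e assume "e \<in> ?L"
    then obtain x y \<sigma> where e: "e = {x, y}" "x \<noteq> y" and \<sigma>: "\<sigma> \<in> hom g H" "cell g \<sigma> = closed_segment x y"
      by (auto simp: image_iff)
    obtain X Y where "X \<in> ?K" "Y \<in> ?K" "card (X - Y) = 1" "card (Y - X) = 1" "e = point g ` {X, Y}"
      by (rule segment_cell_exchange[OF \<sigma> e(2)]) (use e(1) in auto)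
    then show "e \<in> ?R" by blast
  next
    fix e assume "e \<in> ?R"
    then obtain X Y where XY: "X \<in> ?K" "Y \<in> ?K" "card (X - Y) = 1" "card (Y - X) = 1" "e = point g ` {X, Y}"
      by blast
    then have "closed_segment (point g X) (point g Y) \<in> cell g ` hom g H"
      by (intro exchange_cell) auto
    moreover have "point g X \<noteq> point g Y" using inj[OF XY(1,2)] XY(3) by auto
    moreover have "e = {point g X, point g Y}" using XY(5) by simp
    ultimately show "e \<in> ?L" by blast
  qed
qed

text \<open>A transversal simplex contains a choice of \<open>g\<close> distinct vertices, one from
  each block, and its dimension leaves no room for another. Conversely an enumeration of a clique
  with \<open>g\<close> elements gives singleton blocks.\<close>

lemma transversal_simplices:
  "{F \<in> (\<lambda>\<sigma>. face (\<Union>i<g. \<sigma> i)) ` {\<sigma> \<in> hom_plus g H. transversal g \<sigma>}. is_simplex (int g - 1) F}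
    = face ` {K. clique H K \<and> card K = g}" (is "?L = ?R")
proof (intro set_eqI iffI)
  fix F assume "F \<in> ?L"
  then obtain \<sigma> where \<sigma>: "\<sigma> \<in> hom_plus g H" "transversal g \<sigma>" and F: "F = face (\<Union>i<g. \<sigma> i)"
    and s: "is_simplex (int g - 1) F" by blast
  obtain f where f: "\<And>i. i < g \<Longrightarrow> f i \<in> \<sigma> i" using transversal_choice[OF \<sigma>(2)] by blast
  note K = choice_clique[OF \<sigma>(1) f]
  have fin: "finite (\<Union>i<g. \<sigma> i)" using finite_hom[OF \<sigma>(1)] by blast
  then have "card (\<Union>i<g. \<sigma> i) \<le> g" using card_le_if_is_simplex_face[OF fin, of "int g - 1"] s F by simp
  moreover have c: "card (f ` {..<g}) = g" using K(1) by (simp add: card_image)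
  ultimately have "f ` {..<g} = (\<Union>i<g. \<sigma> i)"
    by (intro card_seteq[OF fin]) (use f in auto)
  then show "F \<in> ?R" using K(2) c F by auto
next
  fix F assume "F \<in> ?R"
  then obtain K where K: "clique H K" "card K = g" "F = face K" by blast
  obtain f where f: "inj_on f {..<g}" "K = f ` {..<g}" by (rule clique_enum[OF K(1,2)])
  let ?\<sigma> = "restrict (\<lambda>i. {f i}) {..<g}"
  have "?\<sigma> \<in> {\<sigma> \<in> hom_plus g H. transversal g \<sigma>}" using singletons_hom f K(1) by (simp add: hom_eq)
  moreover have "F = face (\<Union>i<g. ?\<sigma> i)" unfolding K(3) f(2) by (rule arg_cong[of _ _ face]) auto
  moreover have "is_simplex (int g - 1) F" using is_simplex_face[of K] K f by simp
  ultimately show "F \<in> ?L" by blast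
qed

end

section \<open>The complexes of the dissections\<close>

lemma clique_I_graph:
  "clique (I_graph k m Q) K \<longleftrightarrow> K \<subseteq> allowable k m Q \<and> pairwise noncrossing K"
proof -
  have "{u, v} \<in> edges (I_graph k m Q) \<longleftrightarrow> u \<in> allowable k m Q \<and> v \<in> allowable k m Q \<and> u \<noteq> v \<and> noncrossing u v"
    for u v unfolding I_graph_def snd_conv
    by (auto simp: doubleton_eq_iff noncrossing_sym[of u v])
  moreover have "verts (I_graph k m Q) = allowable k m Q" by (simp add: I_graph_def)
  ultimately show ?thesis unfolding clique_def pairwise_def by (simp add: subset_iff) blast
qed

lemma clique_bounded_I_graph:
  assumes "3 \<le> k" "1 \<le> m" "convex_gon (m * (k - 2) + 2) Q"
  shows "clique_bounded_graph (I_graph k m Q) (m - 1)"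
proof
  show "finite (verts (I_graph k m Q))"
    using assms(3) finite_allowable by (auto simp: I_graph_def convex_gon_def)
  show "{u} \<notin> edges (I_graph k m Q)" for u by (auto simp: I_graph_def)
  fix K assume "clique (I_graph k m Q) K"
  then obtain X where X: "X \<in> dissections k m Q" "K \<subseteq> X"
    unfolding clique_I_graph using noncrossing_allowable_extend[OF assms] by blast
  then have "finite X"
    using assms(3) finite_diagonals by (auto simp: dissections_def convex_gon_def intro: finite_subset)
  then show "card K \<le> m - 1" using card_mono[OF _ X(2)] X(1) dissections_iff[OF assms] by auto
qed

theorem proposition4p4:
  fixes k m :: nat and Q :: "(real^2) set"
  assumes "k \<ge> 3" and "m \<ge> 1" and "convex_gon (m * (k - 2) + 2) Q"
  shows "(is_polytopal_complex (D_complex k m Q) \<and>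
          is_simplicial_complex (D_plus k m Q) \<and>
          is_simplicial_complex (D_plus_t k m Q) \<and>
          (m \<ge> 2 \<longrightarrow>
             (\<lambda>P. P \<times> {barycenter (m - 1)}) ` D_complex k m Q =
               cayley_section (m - 1) (allowable k m Q) (lifted (m - 1) (hom_plus (m - 1) (I_graph k m Q))) \<and>
             (\<lambda>P. P \<times> {barycenter (m - 1)}) ` D_complex k m Q =
               cayley_section (m - 1) (allowable k m Q) (lifted (m - 1) (hom_plus_t (m - 1) (I_graph k m Q))))) \<and>
         face ` T_complex k m Q =
           induced_complex {F \<in> D_plus k m Q. F \<in> transversal_faces k m Q \<and> is_simplex (int m - 2) F} \<and>
         (\<exists>\<phi>. graph_iso \<phi> (flip_graph k m Q) (one_skeleton (D_complex k m Q)) \<and>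
           (\<forall>d. d ` {..<m - 1} \<in> dissections k m Q \<longrightarrow>
              {\<phi> (d ` {..<m - 1})} = proj (m - 1) ` real_prod (m - 1) (\<lambda>i. {d i})))"
proof -
  define g where "g = m - 1"
  define H where "H = I_graph k m Q"
  interpret clique_bounded_graph H g
    unfolding g_def H_def by (rule clique_bounded_I_graph[OF assms])
  have vertsH: "verts H = allowable k m Q" by (simp add: H_def I_graph_def)
  have diss: "dissections k m Q = {X. clique H X \<and> card X = g}"
    using dissections_iff[OF assms] by (auto simp: clique_I_graph H_def g_def)
  have D: "D_complex k m Q = cell g ` hom g H"
    by (simp add: D_complex_def proj_real_prod g_def H_def)
  have Dp: "D_plus k m Q = (\<lambda>\<sigma>. face (\<Union>i<g. \<sigma> i)) ` hom_plus g H"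
    and Dt: "D_plus_t k m Q = (\<lambda>\<sigma>. face (\<Union>i<g. \<sigma> i)) ` hom_plus_t g H"
    and tr: "transversal_faces k m Q = (\<lambda>\<sigma>. face (\<Union>i<g. \<sigma> i)) ` {\<sigma> \<in> hom_plus g H. transversal g \<sigma>}"
    by (simp_all add: D_plus_def D_plus_t_def transversal_faces_def proj_real_join g_def H_def)
  have t_sub: "hom_plus_t g H \<subseteq> hom_plus g H" by (auto simp: hom_plus_t_def)
  have sec: "m \<ge> 2 \<longrightarrow>
      (\<lambda>P. P \<times> {barycenter g}) ` D_complex k m Q = cayley_section g (allowable k m Q) (lifted g (hom_plus g H)) \<and>
      (\<lambda>P. P \<times> {barycenter g}) ` D_complex k m Q = cayley_section g (allowable k m Q) (lifted g (hom_plus_t g H))"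
  proof
    assume "m \<ge> 2"
    then have "0 < g" by (simp add: g_def)
    then show "(\<lambda>P. P \<times> {barycenter g}) ` D_complex k m Q = cayley_section g (allowable k m Q) (lifted g (hom_plus g H)) \<and>
      (\<lambda>P. P \<times> {barycenter g}) ` D_complex k m Q = cayley_section g (allowable k m Q) (lifted g (hom_plus_t g H))"
      unfolding D using cayley_section_lifted[OF finite_verts _ order_refl] cayley_section_lifted[OF finite_verts _ t_sub]
      by (simp only: vertsH flip: hom_eq hom_eq_t)
  qed
  have T: "face ` T_complex k m Q =
      induced_complex {F \<in> D_plus k m Q. F \<in> transversal_faces k m Q \<and> is_simplex (int m - 2) F}"
  proof -
    \<comment> \<open>Transversal faces are members of \<open>D_plus\<close> already, and
      \<open>m \<ge> 1\<close> turns \<open>int m - 2\<close> into \<open>int g - 1\<close>.\<close>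
    have "{F \<in> D_plus k m Q. F \<in> transversal_faces k m Q \<and> is_simplex (int m - 2) F} =
        {F \<in> transversal_faces k m Q. is_simplex (int g - 1) F}"
      using assms(2) unfolding Dp tr g_def by (auto simp: of_nat_diff)
    also have "\<dots> = face ` dissections k m Q"
      unfolding tr diss by (rule transversal_simplices)
    also have "induced_complex \<dots> = face ` T_complex k m Q"
    proof (intro set_eqI iffI)
      have fin: "finite X" if "X \<in> dissections k m Q" for X
        using that finite_subset[OF _ finite_verts] by (auto simp: diss clique_def)
      fix F
      show "F \<in> face ` T_complex k m Q" if F: "F \<in> induced_complex (face ` dissections k m Q)"
      proof -
        obtain X where X: "X \<in> dissections k m Q" "F face_of face X"
          using F by (auto simp: induced_complex_def)
        then obtain S where S: "S \<subseteq> X" "F = face S" using face_of_face_iff[OF fin[OF X(1)]] by auto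
        have "S \<in> T_complex k m Q"
          using X(1) S(1) dissections_iff[OF assms] by (auto simp: T_complex_def intro: pairwise_subset)
        then show ?thesis using S(2) by blast
      qed
      show "F \<in> induced_complex (face ` dissections k m Q)" if F: "F \<in> face ` T_complex k m Q"
      proof -
        obtain S where S: "S \<in> T_complex k m Q" "F = face S" using F by blast
        then have "S \<subseteq> allowable k m Q" "pairwise noncrossing S" by (simp_all add: T_complex_def)
        \<comment> \<open>The extension property makes every simplex of \<open>T_complex\<close> a
          face of one with \<open>m - 1\<close> vertices, as an induced complex requires.\<close>
        then obtain X where X: "X \<in> dissections k m Q" "S \<subseteq> X"
          using noncrossing_allowable_extend[OF assms] by blast
        then have "F face_of face X" using S(2) face_face_of[OF fin[OF X(1)] X(2)] by simp
        then show ?thesis using X(1) by (auto simp: induced_complex_def)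
      qed
    qed
    finally show ?thesis by simp
  qed
  have iso: "graph_iso (point g) (flip_graph k m Q) (one_skeleton (D_complex k m Q))"
    unfolding flip_graph_def diss D by (rule graph_iso_one_skeleton)
  have pt: "{point g (d ` {..<g})} = proj g ` real_prod g (\<lambda>i. {d i})" if "d ` {..<g} \<in> dissections k m Q" for d
  proof -
    \<comment> \<open>A dissection has \<open>g\<close> elements, so an enumeration of it by
      \<open>{..<g}\<close> has no repetitions.\<close>
    have "inj_on d {..<g}" using that by (intro eq_card_imp_inj_on) (auto simp: diss)
    then show ?thesis by (simp add: proj_real_prod cell_singletons)
  qed
  have sc: "is_simplicial_complex (D_plus k m Q)" "is_simplicial_complex (D_plus_t k m Q)"
    unfolding Dp Dt
    using simplicial_complex_faces[OF finite_verts order_refl restrict_cell_hom_plus]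
      simplicial_complex_faces[OF finite_verts t_sub restrict_cell_hom_plus_t] by blast+
  have pc: "is_polytopal_complex (D_complex k m Q)"
    unfolding D by (rule polytopal_complex_cells)
  show ?thesis
    using pc sc sec T iso pt unfolding g_def H_def by blast
qed

end
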